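(* Let $\mu$ be a strict partition of $m$ and let $f\in\Gamma$ be a supersymmetric function. Then $$\mathbb{E}_{\mu,n}[f]=\sum_{\lambda\in\mathcal{SP}_{n+m}}\frac{m!}{(n+m)!}\,2^{n-\ell(\lambda)+\ell(\mu)}\,\frac{g^\lambda}{g^\mu}\,g^{\lambda/\mu}\,f(\lambda)$$ is a polynomial function in $n$ (i.e. agrees with a fixed polynomial in $n$ for all integers $n\ge0$).
   Context: A partition is a finite weakly decreasing sequence $\lambda=(\lambda_1,\dots,\lambda_l)$ of positive integers; $\ell(\lambda)=l$, $|\lambda|=\sum_i\lambda_i$. It is strict if all parts are distinct; $\mathcal{SP}_n$ is the set of strict partitions of $n$ ($\mathcal{SP}_0=\{\emptyset\}$). The shifted Young diagram of strict $\lambda$ is $S(\lambda)=\{(i,j)\in\mathbb{Z}^2:1\le i\le\ell(\lambda),\ i\le j\le\lambda_i+i-1\}$. For strict $\lambda,\mu$ with $S(\lambda)\supseteq S(\mu)$ and $k=|\lambda|-|\mu|$, $g^{\lambda/\mu}$ is the number of sequences $\mu=\lambda^{(0)},\dots,\lambda^{(k)}=\lambda$ of strict partitions with each $S(\lambda^{(i)})$ obtained from $S(\lambda^{(i-1)})$ by adding exactly one box; $g^{\lambda/\mu}=0$ if $S(\lambda)\not\supseteq S(\mu)$; $g^\lambda=g^{\lambda/\emptyset}$. $p_r=x_1^r+x_2^r+\cdots$ is the power sum; $\Gamma$ is the $\mathbb{Q}$-subalgebra of symmetric functions generated by $p_1,p_3,p_5,\dots$ (supersymmetric functions). For $f\in\Gamma$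 and strict $\lambda$, $f(\lambda)=f(\lambda_1,\dots,\lambda_{\ell(\lambda)},0,0,\dots)$. *)

theory Defs
  imports
    "HOL-Library.Poly_Mapping"
    "HOL-Computational_Algebra.Polynomial"
begin

section \<open>Strict partitions and shifted diagrams\<close>

definition is_partition :: "nat list \<Rightarrow> bool" where
  "is_partition l \<longleftrightarrow> sorted_wrt (\<ge>) l \<and> (\<forall>p \<in> set l. 0 < p)"

definition strict_partition :: "nat list \<Rightarrow> bool" where
  "strict_partition l \<longleftrightarrow> is_partition l \<and> distinct l"

definition strict_partitions :: "nat \<Rightarrow> nat list set" where
  "strict_partitions n = {l. strict_partition l \<and> sum_list l = n}"

text \<open>Boxes are indexed from 1, while the part \<open>\<lambda>\<^sub>i\<close> is the list entry \<open>l ! (i - 1)\<close>.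
  All coordinates of boxes are positive, so pairs of naturals suffice.\<close>

definition shifted_diagram :: "nat list \<Rightarrow> (nat \<times> nat) set" where
  "shifted_diagram l =
    {(i, j). 1 \<le> i \<and> i \<le> length l \<and> i \<le> j \<and> j \<le> l ! (i - 1) + i - 1}"

definition adds_one_box :: "nat list \<Rightarrow> nat list \<Rightarrow> bool" where
  "adds_one_box l l' \<longleftrightarrow>
    (\<exists>b. b \<notin> shifted_diagram l \<and> shifted_diagram l' = insert b (shifted_diagram l))"

definition shifted_chains :: "nat list \<Rightarrow> nat list \<Rightarrow> nat list list set" where
  "shifted_chains lam mu =
    (let k = sum_list lam - sum_list mu in
      {c. length c = k + 1 \<and> c ! 0 = mu \<and> c ! k = lam \<and>
          (\<forall>nu \<in> set c. strict_partition nu) \<and>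
          (\<forall>i<k. adds_one_box (c ! i) (c ! Suc i))})"

definition g_skew :: "nat list \<Rightarrow> nat list \<Rightarrow> nat" where
  "g_skew lam mu =
    (if shifted_diagram mu \<subseteq> shifted_diagram lam then card (shifted_chains lam mu) else 0)"

definition g_straight :: "nat list \<Rightarrow> nat" where
  "g_straight lam = g_skew lam []"


section \<open>Supersymmetric functions\<close>

text \<open>A formal power series with rational coefficients in the countably many variables
  \<open>x\<^sub>0, x\<^sub>1, \<dots>\<close> is the family of its coefficients; a monomial is given by its finitely
  supported exponent vector.\<close>

type_synonym monomial = "nat \<Rightarrow>\<^sub>0 nat"
type_synonym series = "monomial \<Rightarrow> rat"

definition series_const :: "rat \<Rightarrow> series" where
  "series_const c = (\<lambda>e. if e = 0 then c else 0)"

definition series_add :: "series \<Rightarrow> series \<Rightarrow> series" where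
  "series_add f g = (\<lambda>e. f e + g e)"

definition series_mult :: "series \<Rightarrow> series \<Rightarrow> series" where
  "series_mult f g = (\<lambda>e. \<Sum>(a, b) \<in> {(a, b). a + b = e}. f a * g b)"

definition power_sum :: "nat \<Rightarrow> series" where
  "power_sum r = (\<lambda>e. if \<exists>i. e = Poly_Mapping.single i r then 1 else 0)"

text \<open>The ring of symmetric functions: invariant under permutations of the variables and
  of bounded degree.\<close>

definition mon_degree :: "monomial \<Rightarrow> nat" where
  "mon_degree e = (\<Sum>i \<in> Poly_Mapping.keys e. Poly_Mapping.lookup e i)"

definition symmetric_functions :: "series set" where
  "symmetric_functions =
    {f. (\<exists>d. \<forall>e. f e \<noteq> 0 \<longrightarrow> mon_degree e \<le> d) \<and>
        (\<forall>\<pi> e e'. bij \<pi> \<longrightarrow> (\<forall>i. Poly_Mapping.lookup e' i = Poly_Mapping.lookup e (\<pi> i)) \<longrightarrow> f e' = f e)}"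

text \<open>Closure under multiplication by scalars is closure under multiplication by
  constants.\<close>

inductive_set supersymmetric_functions :: "series set" where
  const: "series_const c \<in> supersymmetric_functions"
| odd_power_sum: "odd r \<Longrightarrow> power_sum r \<in> supersymmetric_functions"
| add: "f \<in> supersymmetric_functions \<Longrightarrow> g \<in> supersymmetric_functions \<Longrightarrow>
    series_add f g \<in> supersymmetric_functions"
| mult: "f \<in> supersymmetric_functions \<Longrightarrow> g \<in> supersymmetric_functions \<Longrightarrow>
    series_mult f g \<in> supersymmetric_functions"

definition eval_monomial :: "monomial \<Rightarrow> (nat \<Rightarrow> rat) \<Rightarrow> rat" where
  "eval_monomial e x = (\<Prod>i \<in> Poly_Mapping.keys e. x i ^ Poly_Mapping.lookup e i)"

text \<open>\<^const>\<open>Sum_any\<close> sums over the monomials with nonzero contribution.  For \<open>f\<close> of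
  bounded degree and \<open>x\<close> of finite support there are only finitely many of them.\<close>

definition eval_series :: "series \<Rightarrow> (nat \<Rightarrow> rat) \<Rightarrow> rat" where
  "eval_series f x = (\<Sum>e. f e * eval_monomial e x)"

definition eval_partition :: "series \<Rightarrow> nat list \<Rightarrow> rat" where
  "eval_partition f l = eval_series f (\<lambda>i. if i < length l then of_nat (l ! i) else 0)"


subsection \<open>Well-definedness of these notions\<close>

lemma finite_strict_partitions: "finite (strict_partitions n)"
proof (rule finite_subset)
  show "finite {l. set l \<subseteq> {..n} \<and> length l \<le> n}"
    by (rule finite_lists_length_le) simp
  have "length l \<le> sum_list l" if "\<forall>p \<in> set l. 0 < p" for l :: "nat list"
    using that by (induction l) auto
  then show "strict_partitions n \<subseteq> {l. set l \<subseteq> {..n} \<and> length l \<le> n}"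
    by (auto simp: strict_partitions_def strict_partition_def is_partition_def member_le_sum_list)
qed

lemma finite_shifted_diagram: "finite (shifted_diagram l)"
proof (rule finite_subset)
  show "shifted_diagram l \<subseteq> (SIGMA i:{..length l}. {..l ! (i - 1) + i - 1})"
    by (auto simp: shifted_diagram_def)
qed auto

lemma finite_strict_partitions_below:
  "finite {nu. strict_partition nu \<and> shifted_diagram nu \<subseteq> shifted_diagram lam}"
proof -
  have "finite (fst ` shifted_diagram lam \<union> snd ` shifted_diagram lam)"
    by (simp add: finite_shifted_diagram)
  then obtain N where "\<forall>n \<in> fst ` shifted_diagram lam \<union> snd ` shifted_diagram lam. n \<le> N"
    unfolding finite_nat_set_iff_bounded_le by blast
  then have N: "i \<le> N \<and> j \<le> N" if "(i, j) \<in> shifted_diagram lam" for i j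
    using that by (force simp: image_iff)
  have "set nu \<subseteq> {..N} \<and> length nu \<le> N"
    if nu: "strict_partition nu" "shifted_diagram nu \<subseteq> shifted_diagram lam" for nu
  proof -
    have "p \<le> N \<and> Suc i \<le> N" if "i < length nu" "p = nu ! i" for i p
    proof -
      have "0 < p" using nu(1) that by (auto simp: strict_partition_def is_partition_def)
      with that have "(Suc i, p + i) \<in> shifted_diagram nu" by (auto simp: shifted_diagram_def)
      with nu(2) N show ?thesis by fastforce
    qed
    then show ?thesis
      by (auto simp: in_set_conv_nth) (metis Suc_pred le0 lessI not_gr_zero diff_less zero_less_one)
  qed
  then show ?thesis
    by (intro finite_subset[OF _ finite_lists_length_le[of "{..N}" N]]) auto
qed

lemma finite_shifted_chains: "finite (shifted_chains lam mu)"
proof -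
  define k where "k = sum_list lam - sum_list mu"
  have "set c \<subseteq> {nu. strict_partition nu \<and> shifted_diagram nu \<subseteq> shifted_diagram lam}"
    if c: "c \<in> shifted_chains lam mu" for c
  proof
    fix nu assume "nu \<in> set c"
    have c': "length c = k + 1" "c ! k = lam" "\<forall>nu \<in> set c. strict_partition nu"
      "\<And>i. i < k \<Longrightarrow> adds_one_box (c ! i) (c ! Suc i)"
      using c by (auto simp: shifted_chains_def k_def Let_def)
    from \<open>nu \<in> set c\<close> c'(1) obtain i where i: "i \<le> k" "nu = c ! i"
      by (auto simp: in_set_conv_nth less_Suc_eq_le)
    from i(1) have "shifted_diagram (c ! i) \<subseteq> shifted_diagram (c ! k)"
    proof (induction rule: inc_induct)
      case (step j)
      from c'(4)[OF step(2)] step.IH show ?case by (auto simp: adds_one_box_def)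
    qed simp
    with i(2) c' \<open>nu \<in> set c\<close>
    show "nu \<in> {nu. strict_partition nu \<and> shifted_diagram nu \<subseteq> shifted_diagram lam}" by auto
  qed
  moreover have "length c = k + 1" if "c \<in> shifted_chains lam mu" for c
    using that by (auto simp: shifted_chains_def k_def Let_def)
  ultimately show ?thesis
    by (intro finite_subset[OF _ finite_lists_length_eq[OF finite_strict_partitions_below[of lam],
          of "k + 1"]]) blast
qed

lemma finite_decompositions: "finite {(a, b). a + b = (e :: monomial)}"
proof -
  define h where "h = (\<lambda>a :: monomial. \<lambda>i. Poly_Mapping.lookup a i)"
  have sub: "fst ` {(a, b). a + b = e} \<subseteq>
      {a. h a \<in> {u. \<forall>i. (i \<in> Poly_Mapping.keys e \<longrightarrow> u i \<in> {..Max (range (Poly_Mapping.lookup e))})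
          \<and> (i \<notin> Poly_Mapping.keys e \<longrightarrow> u i = 0)}}"
  proof clarsimp
    fix a b :: monomial and i
    have le: "Poly_Mapping.lookup a i \<le> Poly_Mapping.lookup (a + b) i" by (simp add: lookup_add)
    have "range (Poly_Mapping.lookup (a + b)) \<subseteq> insert 0 (Poly_Mapping.lookup (a + b) ` Poly_Mapping.keys (a + b))"
      by (auto simp: in_keys_iff)
    then have "finite (range (Poly_Mapping.lookup (a + b)))"
      by (rule finite_subset) simp
    then have "Poly_Mapping.lookup (a + b) i \<le> Max (range (Poly_Mapping.lookup (a + b)))" by simp
    with le show "(i \<in> Poly_Mapping.keys (a + b) \<longrightarrow> h a i \<le> Max (range (Poly_Mapping.lookup (a + b)))) \<and>
        (i \<notin> Poly_Mapping.keys (a + b) \<longrightarrow> h a i = 0)"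
      by (auto simp: h_def in_keys_iff)
  qed
  have "inj h" by (intro injI poly_mapping_eqI) (simp add: h_def fun_eq_iff)
  have "finite {u. \<forall>i. (i \<in> Poly_Mapping.keys e \<longrightarrow> u i \<in> {..Max (range (Poly_Mapping.lookup e))})
          \<and> (i \<notin> Poly_Mapping.keys e \<longrightarrow> u i = (0::nat))}"
    by (rule finite_set_of_finite_funs) auto
  from finite_vimageI[OF this \<open>inj h\<close>]
  have "finite (fst ` {(a, b). a + b = e})"
    by (intro finite_subset[OF sub]) (simp add: vimage_def)
  moreover have "inj_on fst {(a, b). a + b = e}"
    by (auto simp: inj_on_def)
  ultimately show ?thesis by (rule finite_imageD)
qed

lemma mon_degree_superset:
  assumes "finite A" "Poly_Mapping.keys e \<subseteq> A"
  shows "mon_degree e = (\<Sum>i \<in> A. Poly_Mapping.lookup e i)"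
  unfolding mon_degree_def using assms
  by (intro sum.mono_neutral_left) (auto simp: in_keys_iff)

lemma mon_degree_add: "mon_degree (a + b) = mon_degree a + mon_degree b"
proof -
  let ?A = "Poly_Mapping.keys a \<union> Poly_Mapping.keys b"
  have "finite ?A" "Poly_Mapping.keys (a + b) \<subseteq> ?A" "Poly_Mapping.keys a \<subseteq> ?A" "Poly_Mapping.keys b \<subseteq> ?A"
    by (auto simp: in_keys_iff lookup_add)
  then show ?thesis
    by (simp add: mon_degree_superset[of ?A] lookup_add sum.distrib)
qed

lemma eval_monomial_superset:
  assumes "finite A" "Poly_Mapping.keys e \<subseteq> A"
  shows "eval_monomial e x = (\<Prod>i \<in> A. x i ^ Poly_Mapping.lookup e i)"
  unfolding eval_monomial_def using assms
  by (intro prod.mono_neutral_left) (auto simp: in_keys_iff)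

lemma eval_monomial_add: "eval_monomial (a + b) x = eval_monomial a x * eval_monomial b x"
proof -
  let ?A = "Poly_Mapping.keys a \<union> Poly_Mapping.keys b"
  have "finite ?A" "Poly_Mapping.keys (a + b) \<subseteq> ?A" "Poly_Mapping.keys a \<subseteq> ?A" "Poly_Mapping.keys b \<subseteq> ?A"
    by (auto simp: in_keys_iff lookup_add)
  then show ?thesis
    by (simp add: eval_monomial_superset[of ?A] lookup_add power_add prod.distrib)
qed

lemma eval_monomial_nonzero:
  assumes "eval_monomial e x \<noteq> 0" "i \<in> Poly_Mapping.keys e"
  shows "x i \<noteq> 0"
proof
  assume "x i = 0"
  with assms(2) have "x i ^ Poly_Mapping.lookup e i = 0" by (simp add: in_keys_iff)
  with assms(2) have "eval_monomial e x = 0"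
    unfolding eval_monomial_def by (intro prod_zero) auto
  with assms(1) show False by simp
qed

lemma finite_bounded_monomials:
  assumes "finite A"
  shows "finite {e. Poly_Mapping.keys e \<subseteq> A \<and> mon_degree e \<le> d}"
proof -
  have inj: "inj Poly_Mapping.lookup" by (intro injI poly_mapping_eqI) simp
  have "finite {u. \<forall>i. (i \<in> A \<longrightarrow> u i \<in> {..d}) \<and> (i \<notin> A \<longrightarrow> u i = (0::nat))}"
    by (rule finite_set_of_finite_funs) (use assms in auto)
  from finite_vimageI[OF this inj] show ?thesis
  proof (rule finite_subset[rotated], intro subsetI)
    fix e assume e: "e \<in> {e. Poly_Mapping.keys e \<subseteq> A \<and> mon_degree e \<le> d}"
    have "Poly_Mapping.lookup e i \<le> d" if "i \<in> A" for i
      using member_le_sum[of i A "Poly_Mapping.lookup e"] that e assms mon_degree_superset[of A e] by auto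
    with e show "e \<in> Poly_Mapping.lookup -` {u. \<forall>i. (i \<in> A \<longrightarrow> u i \<in> {..d}) \<and> (i \<notin> A \<longrightarrow> u i = 0)}"
      by (auto simp: in_keys_iff)
  qed
qed

lemma eval_series_bounded:
  assumes A: "finite A" "{i. x i \<noteq> 0} \<subseteq> A" and f: "\<And>e. f e \<noteq> 0 \<Longrightarrow> mon_degree e \<le> d"
  shows "eval_series f x = (\<Sum>e | Poly_Mapping.keys e \<subseteq> A \<and> mon_degree e \<le> d. f e * eval_monomial e x)"
  unfolding eval_series_def
proof (rule Sum_any.expand_superset)
  show "finite {e. Poly_Mapping.keys e \<subseteq> A \<and> mon_degree e \<le> d}"
    by (rule finite_bounded_monomials[OF A(1)])
  show "{e. f e * eval_monomial e x \<noteq> 0} \<subseteq> {e. Poly_Mapping.keys e \<subseteq> A \<and> mon_degree e \<le> d}"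
    using eval_monomial_nonzero A(2) f by fastforce
qed

lemma series_mult_bounded:
  assumes "\<And>e. f e \<noteq> 0 \<Longrightarrow> mon_degree e \<le> d" "\<And>e. g e \<noteq> 0 \<Longrightarrow> mon_degree e \<le> d'"
    and "series_mult f g e \<noteq> 0"
  shows "mon_degree e \<le> d + d'"
proof -
  from assms(3) obtain a b where "a + b = e" "f a * g b \<noteq> 0"
    unfolding series_mult_def by (auto elim!: sum.not_neutral_contains_not_neutral)
  with assms(1)[of a] assms(2)[of b] show ?thesis
    by (auto simp: mon_degree_add)
qed

lemma mon_degree_single [simp]: "mon_degree (Poly_Mapping.single i r) = r"
  by (simp add: mon_degree_def)

lemma supersymmetric_bounded:
  assumes "f \<in> supersymmetric_functions"
  shows "\<exists>d. \<forall>e. f e \<noteq> 0 \<longrightarrow> mon_degree e \<le> d"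
  using assms
proof induction
  case (const c)
  then show ?case by (intro exI[of _ 0]) (auto simp: series_const_def mon_degree_def)
next
  case (odd_power_sum r)
  then show ?case by (intro exI[of _ r]) (auto simp: power_sum_def)
next
  case (add f g)
  then obtain d d' where "\<forall>e. f e \<noteq> 0 \<longrightarrow> mon_degree e \<le> d" "\<forall>e. g e \<noteq> 0 \<longrightarrow> mon_degree e \<le> d'"
    by blast
  then show ?case
    by (intro exI[of _ "max d d'"] allI) (metis add_0 le_max_iff_disj series_add_def)
next
  case (mult f g)
  then obtain d d' where "\<forall>e. f e \<noteq> 0 \<longrightarrow> mon_degree e \<le> d" "\<forall>e. g e \<noteq> 0 \<longrightarrow> mon_degree e \<le> d'"
    by blast
  then show ?case
    using series_mult_bounded[of f d g d'] by blast
qed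

lemma permuted_monomial:
  fixes e :: monomial
  assumes "bij \<pi>"
  obtains e' :: monomial where "\<And>i. Poly_Mapping.lookup e' i = Poly_Mapping.lookup e (\<pi> i)"
proof -
  have "{i. Poly_Mapping.lookup e (\<pi> i) \<noteq> 0} = \<pi> -` Poly_Mapping.keys e" by (auto simp: in_keys_iff)
  then have "finite {i. Poly_Mapping.lookup e (\<pi> i) \<noteq> 0}"
    using assms by (simp add: finite_vimageI bij_is_inj)
  then show thesis
    using that[of "Abs_poly_mapping (\<lambda>i. Poly_Mapping.lookup e (\<pi> i))"] by simp
qed

lemma supersymmetric_symmetric:
  assumes "f \<in> supersymmetric_functions"
  shows "bij \<pi> \<Longrightarrow> (\<And>i. Poly_Mapping.lookup e' i = Poly_Mapping.lookup e (\<pi> i)) \<Longrightarrow> f e' = f e"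
  using assms
proof (induction arbitrary: e e')
  case (const c)
  have "e' = 0 \<longleftrightarrow> e = 0"
  proof
    assume "e' = 0"
    then have "Poly_Mapping.lookup e j = 0" for j
      using const.prems(2)[of "inv \<pi> j"] const.prems(1) by (simp add: surj_f_inv_f bij_is_surj)
    then show "e = 0" by (intro poly_mapping_eqI) simp
  next
    assume "e = 0"
    then show "e' = 0" using const.prems(2) by (intro poly_mapping_eqI) simp
  qed
  then show ?case by (simp add: series_const_def)
next
  case (odd_power_sum r)
  have "(\<exists>i. e' = Poly_Mapping.single i r) \<longleftrightarrow> (\<exists>i. e = Poly_Mapping.single i r)"
  proof
    assume "\<exists>i. e' = Poly_Mapping.single i r"
    then obtain i where i: "e' = Poly_Mapping.single i r" by blast
    have "Poly_Mapping.lookup e j = Poly_Mapping.lookup (Poly_Mapping.single (\<pi> i) r) j" for j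
      using odd_power_sum.prems(2)[of "inv \<pi> j", symmetric] odd_power_sum.prems(1) i
      by (auto simp: lookup_single when_def bij_is_surj surj_f_inv_f bij_inv_eq_iff)
    then show "\<exists>i. e = Poly_Mapping.single i r" by (metis poly_mapping_eqI)
  next
    assume "\<exists>i. e = Poly_Mapping.single i r"
    then obtain i where i: "e = Poly_Mapping.single i r" by blast
    have "Poly_Mapping.lookup e' j = Poly_Mapping.lookup (Poly_Mapping.single (inv \<pi> i) r) j" for j
    proof -
      have "inv \<pi> i = j \<longleftrightarrow> i = \<pi> j" 
        using bij_inv_eq_iff[OF odd_power_sum.prems(1), of j i] by auto
      then show ?thesis
        by (simp add: odd_power_sum.prems(2) i lookup_single when_def)
    qed
    then show "\<exists>i. e' = Poly_Mapping.single i r" by (metis poly_mapping_eqI)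
  qed
  then show ?case by (simp add: power_sum_def)
next
  case (add f g)
  from add.IH[OF add.prems] show ?case by (simp add: series_add_def)
next
  case (mult f g)
  define act where "act = (\<lambda>\<rho> :: nat \<Rightarrow> nat. \<lambda>a :: monomial.
      (SOME a'. \<forall>i. Poly_Mapping.lookup a' i = Poly_Mapping.lookup a (\<rho> i)) :: monomial)"
  have act: "Poly_Mapping.lookup (act \<rho> a) i = Poly_Mapping.lookup a (\<rho> i)"
    if \<rho>: "bij \<rho>" for \<rho> a i
  proof -
    obtain a' where "\<forall>i. Poly_Mapping.lookup a' i = Poly_Mapping.lookup a (\<rho> i)"
      using permuted_monomial[OF \<rho>] by blast
    from someI[of "\<lambda>a'. \<forall>i. Poly_Mapping.lookup a' i = Poly_Mapping.lookup a (\<rho> i)", OF this]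
    show ?thesis unfolding act_def by blast
  qed
  have inv: "bij (inv \<pi>)" using mult.prems(1) by (rule bij_imp_bij_inv)
  have e': "e' = act \<pi> e"
    by (rule poly_mapping_eqI) (simp add: mult.prems act)
  have id1: "act (inv \<pi>) (act \<pi> a) = a" for a
    by (rule poly_mapping_eqI) (simp add: act inv mult.prems(1) surj_f_inv_f bij_is_surj)
  have id2: "act \<pi> (act (inv \<pi>) a) = a" for a
    by (rule poly_mapping_eqI) (simp add: act inv mult.prems(1) inv_f_f bij_is_inj)
  have hom: "act \<rho> (a + b) = act \<rho> a + act \<rho> b" if "bij \<rho>" for \<rho> a b
    by (rule poly_mapping_eqI) (simp add: act that lookup_add)
  have decomp: "act (inv \<pi>) a + act (inv \<pi>) b = e" if "a + b = act \<pi> e" for a b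
    using that hom[OF inv, of a b] id1[of e] by simp
  have "series_mult f g e = series_mult f g e'"
    unfolding series_mult_def
  proof (rule sum.reindex_bij_witness[where i = "\<lambda>(a, b). (act (inv \<pi>) a, act (inv \<pi>) b)"
        and j = "\<lambda>(a, b). (act \<pi> a, act \<pi> b)"], goal_cases)
    case (5 p)
    have "f (act \<pi> a) = f a" "g (act \<pi> a) = g a" for a
      using mult.IH act[OF mult.prems(1)] mult.prems(1) by blast+
    then show ?case by (simp add: case_prod_beta)
  qed (auto simp: id1 id2 e' decomp hom[OF mult.prems(1), symmetric])
  then show ?case by simp
qed

lemma supersymmetric_subset_symmetric: "supersymmetric_functions \<subseteq> symmetric_functions"
  using supersymmetric_bounded supersymmetric_symmetric
  unfolding symmetric_functions_def by blast

text \<open>Evaluation at a finitely supported point is an algebra homomorphism that sends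
  power sums to power sums.\<close>

lemma eval_series_const: "eval_series (series_const c) x = c"
proof -
  have "eval_series (series_const c) x =
      (\<Sum>e \<in> {0}. series_const c e * eval_monomial e x)"
    unfolding eval_series_def
    by (rule Sum_any.expand_superset) (auto simp: series_const_def)
  then show ?thesis by (simp add: series_const_def eval_monomial_def)
qed

lemma eval_series_power_sum:
  assumes "finite A" "{i. x i \<noteq> 0} \<subseteq> A" "0 < r"
  shows "eval_series (power_sum r) x = (\<Sum>i \<in> A. x i ^ r)"
proof -
  have mon: "eval_monomial (Poly_Mapping.single i r) x = x i ^ r" for i
    using assms(3) by (simp add: eval_monomial_def)
  have inj: "inj_on (\<lambda>i. Poly_Mapping.single i r) A"
    using assms(3) by (auto simp: inj_on_def poly_mapping_eq_iff fun_eq_iff lookup_single when_def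
        split: if_splits)
  have "eval_series (power_sum r) x =
      (\<Sum>e \<in> (\<lambda>i. Poly_Mapping.single i r) ` A. power_sum r e * eval_monomial e x)"
    unfolding eval_series_def
  proof (rule Sum_any.expand_superset)
    show "{e. power_sum r e * eval_monomial e x \<noteq> 0} \<subseteq> (\<lambda>i. Poly_Mapping.single i r) ` A"
      using assms(2,3) by (auto simp: power_sum_def mon split: if_splits)
  qed (use assms in auto)
  also have "\<dots> = (\<Sum>i \<in> A. x i ^ r)"
    by (subst sum.reindex[OF inj]) (auto simp: power_sum_def mon intro!: sum.cong)
  finally show ?thesis .
qed

lemma eval_series_add:
  assumes "f \<in> symmetric_functions" "g \<in> symmetric_functions" "finite {i. x i \<noteq> 0}"
  shows "eval_series (series_add f g) x = eval_series f x + eval_series g x"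
proof -
  obtain d1 d2 where d: "\<And>e. f e \<noteq> 0 \<Longrightarrow> mon_degree e \<le> d1" "\<And>e. g e \<noteq> 0 \<Longrightarrow> mon_degree e \<le> d2"
    using assms unfolding symmetric_functions_def by blast
  note ev = eval_series_bounded[where d = "max d1 d2", OF assms(3) subset_refl]
  have 1: "mon_degree e \<le> max d1 d2" if "f e \<noteq> 0" for e using d(1)[OF that] by simp
  have 2: "mon_degree e \<le> max d1 d2" if "g e \<noteq> 0" for e using d(2)[OF that] by simp
  have 3: "mon_degree e \<le> max d1 d2" if "series_add f g e \<noteq> 0" for e
    using that 1[of e] 2[of e] by (cases "f e = 0") (simp_all add: series_add_def)
  show ?thesis
    by (simp add: ev[of f, OF 1] ev[of g, OF 2] ev[of "series_add f g", OF 3])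
      (simp add: series_add_def sum.distrib distrib_right)
qed

lemma eval_series_mult:
  assumes "f \<in> symmetric_functions" "g \<in> symmetric_functions" "finite {i. x i \<noteq> 0}"
  shows "eval_series (series_mult f g) x = eval_series f x * eval_series g x"
proof -
  obtain d1 d2 where d: "\<And>e. f e \<noteq> 0 \<Longrightarrow> mon_degree e \<le> d1" "\<And>e. g e \<noteq> 0 \<Longrightarrow> mon_degree e \<le> d2"
    using assms unfolding symmetric_functions_def by blast
  let ?A = "{i. x i \<noteq> 0}"
  define M where "M = (\<lambda>d. {e. Poly_Mapping.keys e \<subseteq> ?A \<and> mon_degree e \<le> d})"
  define t where "t = (\<lambda>(a, b). (f a * eval_monomial a x) * (g b * eval_monomial b x))"
  have finM: "finite (M d)" for d
    unfolding M_def by (rule finite_bounded_monomials[OF assms(3)])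
  have "eval_series (series_mult f g) x =
      (\<Sum>e \<in> M (d1 + d2). series_mult f g e * eval_monomial e x)"
    unfolding M_def using series_mult_bounded[of f d1 g d2] d
    by (intro eval_series_bounded[OF assms(3)]) auto
  also have "\<dots> = (\<Sum>e \<in> M (d1 + d2). \<Sum>p \<in> {(a, b). a + b = e}. t p)"
    unfolding series_mult_def sum_distrib_right
    by (intro sum.cong refl) (auto simp: t_def eval_monomial_add)
  also have "\<dots> = (\<Sum>q \<in> Sigma (M (d1 + d2)) (\<lambda>e. {(a, b). a + b = e}). t (snd q))"
    by (subst sum.Sigma) (auto simp: finM finite_decompositions case_prod_beta)
  also have "\<dots> = (\<Sum>q \<in> (\<lambda>(a, b). (a + b, (a, b))) ` (M d1 \<times> M d2). t (snd q))"
  proof (rule sum.mono_neutral_right)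
    show "finite (Sigma (M (d1 + d2)) (\<lambda>e. {(a, b). a + b = e}))"
      by (intro finite_SigmaI finM finite_decompositions)
    have "Poly_Mapping.keys (a + b) = Poly_Mapping.keys a \<union> Poly_Mapping.keys b" for a b :: monomial
      by (auto simp: in_keys_iff lookup_add)
    note keysadd = this
    show "(\<lambda>(a, b). (a + b, (a, b))) ` (M d1 \<times> M d2) \<subseteq>
        Sigma (M (d1 + d2)) (\<lambda>e. {(a, b). a + b = e})"
      by (auto simp: M_def keysadd mon_degree_add)
    show "\<forall>q \<in> Sigma (M (d1 + d2)) (\<lambda>e. {(a, b). a + b = e}) -
        (\<lambda>(a, b). (a + b, (a, b))) ` (M d1 \<times> M d2). t (snd q) = 0"
    proof (intro ballI, rule ccontr)
      fix q assume q: "q \<in> Sigma (M (d1 + d2)) (\<lambda>e. {(a, b). a + b = e}) -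
          (\<lambda>(a, b). (a + b, (a, b))) ` (M d1 \<times> M d2)" and nz: "t (snd q) \<noteq> 0"
      obtain e a b where eab: "q = (e, (a, b))" by (cases q) auto
      with q have e: "e = a + b" "a + b \<in> M (d1 + d2)" by auto
      have "a \<in> M d1" "b \<in> M d2"
        using nz e(2) d(1)[of a] d(2)[of b] by (auto simp: eab t_def M_def keysadd)
      with q show False by (auto simp: eab e(1))
    qed
  qed
  also have "\<dots> = (\<Sum>p \<in> M d1 \<times> M d2. t p)"
    by (subst sum.reindex) (auto simp: inj_on_def case_prod_beta)
  also have "\<dots> = (\<Sum>a \<in> M d1. f a * eval_monomial a x) * (\<Sum>b \<in> M d2. g b * eval_monomial b x)"
    by (simp add: sum_product sum.cartesian_product t_def)
  also have "\<dots> = eval_series f x * eval_series g x"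
    unfolding M_def using d eval_series_bounded[OF assms(3) subset_refl, of f d1]
      eval_series_bounded[OF assms(3) subset_refl, of g d2] by simp
  finally show ?thesis .
qed

end

theory Submission
  imports Defs "HOL-Computational_Algebra.Polynomial_FPS"
begin

text \<open>Encode a strict partition by its set \<open>S\<close> of parts and write \<open>F(S) = g\<^sup>\<lambda> / |\<lambda>|!\<close>.  Peeling off the last
  box of a path gives \<open>E\<^bsub>\<mu>,n+1\<^esub>[\<phi>] = E\<^bsub>\<mu>,n\<^esub>[T \<phi>]\<close>, where \<open>T\<close> averages \<open>\<phi>\<close> over the ways of adding a box, so it suffices
  that \<open>T - 1\<close> is locally nilpotent on polynomials in odd power sums.  By Schur's product formula for
  \<open>F\<close>, growing the part \<open>x\<close> has as its probability the residue at \<open>z = x(x+1)\<close> of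
  \<open>(1/z) \<Prod>\<^sub>y (z - y(y-1)) / (z - y(y+1))\<close>.  Hence the moments of \<open>x(x+1)\<close> are the coefficients of
  \<open>\<Prod>\<^sub>y (1 - y(y-1)t) / (1 - y(y+1)t)\<close>, which by Newton's identities are polynomials in odd power sums,
  the \<open>k\<close>-th one of weight at most \<open>k\<close> when \<open>p\<^bsub>2k-1\<^esub>\<close> has weight \<open>k\<close>.  As \<open>p\<^bsub>2k-1\<^esub>\<close> changes by
  \<open>(x+1)\<^bsup>2k-1\<^esup> - x\<^bsup>2k-1\<^esup>\<close>, a polynomial of degree \<open>k - 1\<close> in \<open>x(x+1)\<close>, the operator \<open>T - 1\<close> lowers the weight.
  The product formula itself follows from the analogous residue identity for removing a box.\<close>

section \<open>Partial fractions and Newton identities\<close>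

text \<open>For distinct nonzero values \<open>c y\<close>, this is the residue at z = c x of 1/z
  times the product over \<open>y\<close> of (z - d y) / (z - c y).\<close>

definition residue_at :: "('a \<Rightarrow> 'b) \<Rightarrow> ('a \<Rightarrow> 'b) \<Rightarrow> 'a set \<Rightarrow> 'a \<Rightarrow> 'b::field" where
  "residue_at c d S x = (c x - d x) / c x * (\<Prod>y\<in>S - {x}. (c x - d y) / (c x - c y))"

text \<open>The expansion in t of the product of (1 - d y t) / (1 - c y t); a geometric series
  replaces each division.\<close>

definition moment_series :: "('a \<Rightarrow> 'b) \<Rightarrow> ('a \<Rightarrow> 'b) \<Rightarrow> 'a set \<Rightarrow> 'b::field fps" where
  "moment_series c d S = (\<Prod>y\<in>S. Abs_fps (\<lambda>n. c y ^ n) * fps_of_poly [:1, - d y:])"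

lemma geometric_fps: "Abs_fps (\<lambda>n. (c::'a::field) ^ n) * fps_of_poly [:1, -c:] = 1"
proof (rule fps_ext)
  fix n
  show "fps_nth (Abs_fps (\<lambda>n. c ^ n) * fps_of_poly [:1, -c:]) n = fps_nth 1 n"
    by (cases n) (simp_all add: fps_of_poly_pCons algebra_simps)
qed

lemma degree_prod_linear_le:
  "finite S \<Longrightarrow> degree (\<Prod>y\<in>S. [:1, - c y:] :: 'b::field poly) \<le> card S"
  by (rule order_trans[OF degree_prod_sum_le]) (auto intro: order_trans[OF sum_bounded_above[where K=1]])

lemma coeff_prod_linear:
  "finite S \<Longrightarrow> coeff (\<Prod>y\<in>S. [:1, - c y:] :: 'b::field poly) (card S) = (\<Prod>y\<in>S. - c y)"
proof (induction S rule: finite_induct)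
  case (insert x S)
  have "coeff (\<Prod>y\<in>S. [:1, - c y:]) (Suc (card S)) = 0"
    using degree_prod_linear_le[OF insert(1), of c] by (intro coeff_eq_0) simp
  with insert show ?case by simp
qed simp

text \<open>Partial fractions of that product, cleared of denominators. Both sides have degree at
  most \<open>card S\<close>, so it suffices to compare them at the \<open>card S\<close> points 1 /
  c x and in the coefficient of degree \<open>card S\<close>. The last summand on the left comes
  from the pole at z = 0.\<close>

lemma partial_fractions:
  fixes c d :: "'a \<Rightarrow> 'b::field"
  assumes S: "finite S" "inj_on c S" and nz: "\<And>x. x \<in> S \<Longrightarrow> c x \<noteq> 0"
  shows "(\<Sum>x\<in>S. smult (residue_at c d S x) (\<Prod>y\<in>S - {x}. [:1, - c y:]))
      + smult (\<Prod>y\<in>S. d y / c y) (\<Prod>y\<in>S. [:1, - c y:]) = (\<Prod>y\<in>S. [:1, - d y:])"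
    (is "?L = ?R")
proof (rule poly_eqI_degree_lead_coeff)
  let ?n = "card S" and ?A = "(\<lambda>x. inverse (c x)) ` S"
  have deg: "degree (\<Prod>y\<in>S - {x}. [:1, - c y:]) < ?n" if "x \<in> S" for x
    using le_less_trans[OF degree_prod_linear_le card_Diff1_less[OF S(1) that]] S(1) by simp
  \<comment> \<open>Each residue is multiplied by a product lacking one linear factor, so only the
    last summand reaches degree \<open>card S\<close>.\<close>
  show "coeff ?L ?n = coeff ?R ?n"
  proof -
    have "coeff ?L ?n = (\<Prod>y\<in>S. d y / c y) * (\<Prod>y\<in>S. - c y)"
      using deg S by (simp add: coeff_sum coeff_prod_linear coeff_eq_0)
    also have "\<dots> = (\<Prod>y\<in>S. - d y)"
      unfolding prod.distrib[symmetric] using nz by (intro prod.cong) auto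
    finally show ?thesis using S by (simp add: coeff_prod_linear)
  qed
  show "card ?A \<ge> ?n"
    using S by (subst card_image) (auto simp: inj_on_def)
  show "degree ?L \<le> ?n"
    using deg degree_prod_linear_le[OF S(1)]
    by (intro degree_add_le degree_sum_le S order_trans[OF degree_smult_le])
      (auto intro: less_imp_le)
  show "degree ?R \<le> ?n"
    by (rule degree_prod_linear_le[OF S(1)])
  fix z assume "z \<in> ?A"
  then obtain x where x: "x \<in> S" and z: "z = inverse (c x)" by auto
  \<comment> \<open>Here \<open>z\<close> is a value of t, namely 1 / c x. Every product containing
    the factor of \<open>x\<close> vanishes there, so a single residue term survives.\<close>
  have zero: "(\<Prod>y\<in>B. 1 - c y * z) = 0" if "x \<in> B" "B \<subseteq> S" for B
    using that S nz[OF x] by (intro prod_zero bexI[of _ x]) (auto simp: z intro: finite_subset)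
  have others: "(\<Sum>x'\<in>S - {x}. residue_at c d S x' * (\<Prod>y\<in>S - {x'}. 1 - c y * z)) = 0"
    using zero x by (intro sum.neutral) auto
  have "poly ?L z = residue_at c d S x * (\<Prod>y\<in>S - {x}. 1 - c y * z)"
    using S x zero[OF x order_refl] others
    by (simp add: poly_sum poly_prod sum.remove[of S x] mult.commute[of z])
  also have "\<dots> = (c x - d x) / c x * (\<Prod>y\<in>S - {x}. (c x - d y) / (c x - c y) * (1 - c y * z))"
    by (simp add: residue_at_def prod.distrib prod_dividef)
  also have "(\<Prod>y\<in>S - {x}. (c x - d y) / (c x - c y) * (1 - c y * z)) = (\<Prod>y\<in>S - {x}. 1 - d y * z)"
  proof (intro prod.cong refl)
    fix y assume y: "y \<in> S - {x}"
    then have "c x - c y \<noteq> 0" using S x by (auto simp: inj_on_def)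
    then show "(c x - d y) / (c x - c y) * (1 - c y * z) = 1 - d y * z"
      using nz[OF x] by (simp add: z divide_simps)
  qed
  also have "(c x - d x) / c x = 1 - d x * z"
    using nz[OF x] by (simp add: z divide_simps)
  also have "(1 - d x * z) * (\<Prod>y\<in>S - {x}. 1 - d y * z) = poly ?R z"
    using S x by (simp add: poly_prod prod.remove[of S x] algebra_simps)
  finally show "poly ?L z = poly ?R z" .
qed

text \<open>Multiplying the partial fractions by all geometric series leaves each residue times one
  geometric series. The pole at 0 counts for \<open>k = 0\<close> only, as
  \<open>0 ^ 0 = 1\<close>.\<close>

lemma moment_series_nth:
  fixes c d :: "'a \<Rightarrow> 'b::field"
  assumes S: "finite S" "inj_on c S" and nz: "\<And>x. x \<in> S \<Longrightarrow> c x \<noteq> 0"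
  shows "fps_nth (moment_series c d S) k
    = (\<Sum>x\<in>S. residue_at c d S x * c x ^ k) + (\<Prod>y\<in>S. d y / c y) * 0 ^ k"
proof -
  define C where "C = (\<lambda>x. Abs_fps (\<lambda>n. c x ^ n))"
  define Q where "Q = (\<lambda>x. fps_of_poly [:1, - c x:])"
  have CQ: "C x * Q x = 1" for x
    by (simp add: C_def Q_def geometric_fps)
  have all: "(\<Prod>y\<in>S. C y) * (\<Prod>y\<in>S. Q y) = 1"
    by (simp add: prod.distrib[symmetric] CQ)
  have one: "(\<Prod>y\<in>S. C y) * (\<Prod>y\<in>S - {x}. Q y) = C x" if "x \<in> S" for x
  proof -
    have "(\<Prod>y\<in>S. C y) * (\<Prod>y\<in>S - {x}. Q y) = C x * (\<Prod>y\<in>S - {x}. C y * Q y)"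
      using S that by (simp add: prod.remove[of S x] prod.distrib mult.assoc)
    then show ?thesis by (simp add: CQ)
  qed
  have "moment_series c d S = (\<Prod>y\<in>S. C y) * fps_of_poly (\<Prod>y\<in>S. [:1, - d y:])"
    by (simp add: moment_series_def C_def prod.distrib fps_of_poly_prod)
  also have "fps_of_poly (\<Prod>y\<in>S. [:1, - d y:]) =
      (\<Sum>x\<in>S. fps_const (residue_at c d S x) * (\<Prod>y\<in>S - {x}. Q y))
      + fps_const (\<Prod>y\<in>S. d y / c y) * (\<Prod>y\<in>S. Q y)"
    unfolding Q_def
    by (subst partial_fractions[where d = d, OF S nz, symmetric])
      (simp_all only: fps_of_poly_add fps_of_poly_sum fps_of_poly_smult fps_of_poly_prod)
  also have "(\<Prod>y\<in>S. C y) * \<dots> =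
      (\<Sum>x\<in>S. fps_const (residue_at c d S x) * ((\<Prod>y\<in>S. C y) * (\<Prod>y\<in>S - {x}. Q y)))
      + fps_const (\<Prod>y\<in>S. d y / c y) * ((\<Prod>y\<in>S. C y) * (\<Prod>y\<in>S. Q y))"
    by (simp only: distrib_left sum_distrib_left mult.left_commute)
  also have "\<dots> = (\<Sum>x\<in>S. fps_const (residue_at c d S x) * C x) + fps_const (\<Prod>y\<in>S. d y / c y)"
    by (simp add: one all)
  finally show ?thesis
    by (simp add: fps_sum_nth C_def)
qed

section \<open>Newton's identities by logarithmic derivatives\<close>

lemma log_deriv_geometric:
  fixes c :: "'a::field"
  defines "C \<equiv> Abs_fps (\<lambda>n. c ^ n)"
  shows "fps_X * fps_deriv C = C * (C - 1)"
proof -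
  define Q where "Q = fps_of_poly [:1, -c:]"
  have CQ: "C * Q = 1" unfolding C_def Q_def by (rule geometric_fps)
  have Q: "Q = 1 - fps_const c * fps_X"
    by (simp add: Q_def fps_of_poly_pCons fps_const_neg[symmetric] del: fps_const_neg)
  have "0 = fps_deriv (C * Q)" by (simp add: CQ)
  also have "\<dots> = fps_deriv C * Q - fps_const c * C"
    by (simp add: Q algebra_simps)
  finally have "fps_deriv C * Q = fps_const c * C" by simp
  then have "fps_X * fps_deriv C * (C * Q) = C * (C * (fps_const c * fps_X))"
    by (simp add: algebra_simps)
  also have "C * (fps_const c * fps_X) = C - C * Q"
    by (simp add: Q algebra_simps)
  finally show ?thesis by (simp add: CQ)
qed

text \<open>Logarithmic derivatives add over the factors; each factor contributes the geometric
  series of \<open>c y\<close> minus that of \<open>d y\<close>.\<close>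

lemma log_deriv_moment_series:
  fixes c d :: "'a \<Rightarrow> 'b::field"
  shows "finite S \<Longrightarrow> fps_X * fps_deriv (moment_series c d S) =
    moment_series c d S * Abs_fps (\<lambda>r. \<Sum>y\<in>S. c y ^ r - d y ^ r)"
proof (induction S rule: finite_induct)
  case empty
  have "Abs_fps (\<lambda>r. 0) = (0 :: 'b::field fps)" by (rule fps_ext) simp
  then show ?case by (simp add: moment_series_def)
next
  case (insert x S)
  define C where "C = Abs_fps (\<lambda>n. c x ^ n)"
  define D where "D = Abs_fps (\<lambda>n. d x ^ n)"
  define Q where "Q = fps_of_poly [:1, - d x:]"
  define M where "M = moment_series c d S"
  define P where "P = Abs_fps (\<lambda>r. \<Sum>y\<in>S. c y ^ r - d y ^ r)"
  have DQ: "D * Q = 1" unfolding D_def Q_def by (rule geometric_fps)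
  have IH: "fps_X * fps_deriv M = M * P"
    using insert.IH by (simp add: M_def P_def)
  have C: "fps_X * fps_deriv C = C * (C - 1)"
    unfolding C_def by (rule log_deriv_geometric)
  have D: "fps_X * fps_deriv D = D * (D - 1)"
    unfolding D_def by (rule log_deriv_geometric)
  \<comment> \<open>\<open>Q\<close> is the inverse of \<open>D\<close>, so its logarithmic
    derivative is the negative of that of \<open>D\<close>.\<close>
  have Q: "fps_X * fps_deriv Q = Q * (1 - D)"
  proof -
    have "0 = fps_X * fps_deriv (D * Q) * Q" by (simp add: DQ)
    also have "\<dots> = (fps_X * fps_deriv D) * Q * Q + (D * Q) * (fps_X * fps_deriv Q)"
      by (simp add: algebra_simps)
    also have "\<dots> = (D * Q) * (D - 1) * Q + (D * Q) * (fps_X * fps_deriv Q)"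
      by (simp add: D algebra_simps)
    finally have "fps_X * fps_deriv Q = - ((D - 1) * Q)" by (simp add: DQ eq_neg_iff_add_eq_0 add.commute)
    then show ?thesis by (simp add: algebra_simps)
  qed
  have "moment_series c d (insert x S) = C * Q * M"
    using insert by (simp add: moment_series_def C_def Q_def M_def)
  moreover have "Abs_fps (\<lambda>r. \<Sum>y\<in>insert x S. c y ^ r - d y ^ r) = C - D + P"
    using insert by (intro fps_ext) (simp add: C_def D_def P_def)
  moreover have "fps_X * fps_deriv (C * Q * M) =
      (fps_X * fps_deriv C) * Q * M + C * (fps_X * fps_deriv Q) * M + C * Q * (fps_X * fps_deriv M)"
    by (simp add: algebra_simps)
  moreover have "\<dots> = C * Q * M * (C - D + P)"
    unfolding C Q IH by (simp add: algebra_simps)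
  ultimately show ?case by simp
qed

text \<open>Compare coefficients in the logarithmic derivative; the summand \<open>i = k\<close>
  vanishes because \<open>c y ^ 0 - d y ^ 0 = 0\<close>.\<close>

lemma moment_series_newton:
  assumes "finite S"
  shows "of_nat k * fps_nth (moment_series c d S) k =
    (\<Sum>i<k. fps_nth (moment_series c d S) i * (\<Sum>y\<in>S. c y ^ (k - i) - d y ^ (k - i)))"
proof (cases k)
  case (Suc l)
  have "of_nat k * fps_nth (moment_series c d S) k = fps_nth (fps_X * fps_deriv (moment_series c d S)) k"
    by (simp add: Suc)
  also have "\<dots> = (\<Sum>i=0..k. fps_nth (moment_series c d S) i * (\<Sum>y\<in>S. c y ^ (k - i) - d y ^ (k - i)))"
    by (simp add: log_deriv_moment_series[OF assms] fps_mult_nth)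
  also have "\<dots> = (\<Sum>i<k. fps_nth (moment_series c d S) i * (\<Sum>y\<in>S. c y ^ (k - i) - d y ^ (k - i)))"
    by (simp add: atLeast0AtMost lessThan_Suc_atMost[symmetric])
  finally show ?thesis .
qed simp

lemma moment_series_0: "fps_nth (moment_series c d S) 0 = 1"
  by (cases "finite S", induction S rule: finite_induct) (simp_all add: moment_series_def fps_of_poly_pCons)

lemma moment_series_1:
  "finite S \<Longrightarrow> fps_nth (moment_series c d S) 1 = (\<Sum>y\<in>S. c y - d y)"
  using moment_series_newton[of S 1 c d] by (simp add: moment_series_0)

text \<open>The first moment computed twice, from residues and from Newton's identities; the factor
  \<open>c x\<close> cancels the denominator \<open>c x\<close> of the residue. This is the identity
  used for removing a box.\<close>

lemma sum_residues:
  fixes c d :: "'a \<Rightarrow> 'b::field"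
  assumes S: "finite S" "inj_on c S" and nz: "\<And>x. x \<in> S \<Longrightarrow> c x \<noteq> 0"
  shows "(\<Sum>x\<in>S. (c x - d x) * (\<Prod>y\<in>S - {x}. (c x - d y) / (c x - c y))) = (\<Sum>x\<in>S. c x - d x)"
proof -
  have "(\<Sum>x\<in>S. c x - d x) = (\<Sum>x\<in>S. residue_at c d S x * c x)"
    using moment_series_nth[OF assms, where k = 1 and d = d] by (simp add: moment_series_1[OF S(1)] del: One_nat_def)
  also have "\<dots> = (\<Sum>x\<in>S. (c x - d x) * (\<Prod>y\<in>S - {x}. (c x - d y) / (c x - c y)))"
    using nz by (intro sum.cong) (auto simp: residue_at_def)
  finally show ?thesis by simp
qed

section \<open>The growth operator on odd power sums\<close>

definition upper :: "nat \<Rightarrow> rat" where "upper x = of_nat x * (of_nat x + 1)"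

definition lower :: "nat \<Rightarrow> rat" where "lower x = of_nat x * (of_nat x - 1)"

definition psum :: "nat \<Rightarrow> nat set \<Rightarrow> rat" where
  "psum r S = (\<Sum>x\<in>S. of_nat x ^ r)"

text \<open>A strict partition is encoded as its set of parts, and \<open>x = 0\<close> stands for the creation of a new
  part 1.  The weight \<open>add_weight S x\<close> is the transition probability of the growth process.\<close>

definition add_weight :: "nat set \<Rightarrow> nat \<Rightarrow> rat" where
  "add_weight S x = (if x = 0 then \<Prod>y\<in>S. lower y / upper y else residue_at upper lower S x)"

definition add_box :: "nat set \<Rightarrow> nat \<Rightarrow> nat set" where
  "add_box S x = insert (Suc x) (S - {x})"

text \<open>For \<open>k = 0\<close> this is the averaging operator T. Powers of
  \<open>upper x\<close> are included because the increment of an odd power sum is a polynomial in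
  \<open>upper x\<close>.\<close>

definition growth :: "nat \<Rightarrow> (nat set \<Rightarrow> rat) \<Rightarrow> nat set \<Rightarrow> rat" where
  "growth k \<phi> S = (\<Sum>x\<in>insert 0 S. add_weight S x * upper x ^ k * \<phi> (add_box S x))"

definition moment :: "nat \<Rightarrow> nat set \<Rightarrow> rat" where
  "moment k S = fps_nth (moment_series upper lower S) k"

lemma upper_inj: "inj upper"
proof (rule injI)
  fix x y assume "upper x = upper y"
  then have "x * (x + 1) = y * (y + 1)"
    unfolding upper_def by (metis of_nat_1 of_nat_add of_nat_eq_iff of_nat_mult)
  then show "x = y"
    by (metis add_mono1 linorder_neq_iff mult_strict_mono' zero_le less_irrefl_nat)
qed

lemma upper_eq_0: "upper x = 0 \<longleftrightarrow> x = 0"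
proof -
  have "of_nat x + 1 \<noteq> (0::rat)" by (metis of_nat_Suc of_nat_neq_0 add.commute)
  then show ?thesis by (simp add: upper_def)
qed

lemma lower_Suc: "lower (Suc x) = upper x"
  by (simp add: lower_def upper_def algebra_simps)

text \<open>A part \<open>x\<close> with \<open>x + 1 \<in> S\<close> cannot grow; its weight vanishes since \<open>lower (x + 1) = upper x\<close>.\<close>
lemma add_weight_blocked:
  assumes "finite S" "Suc x \<in> S"
  shows "add_weight S x = 0"
proof (cases "x = 0")
  case True
  have "(\<Prod>y\<in>S. lower y / upper y) = 0"
    using assms True by (intro prod_zero bexI[of _ 1]) (auto simp: lower_def)
  with True show ?thesis by (simp add: add_weight_def)
next
  case False
  have "(\<Prod>y\<in>S - {x}. (upper x - lower y) / (upper x - upper y)) = 0"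
    using assms by (intro prod_zero bexI[of _ "Suc x"]) (auto simp: lower_Suc)
  with False show ?thesis by (simp add: add_weight_def residue_at_def)
qed

text \<open>Since \<open>upper 0 = 0\<close>, the summand \<open>x = 0\<close> is the contribution
  of the pole at 0, so creating a part 1 fits the same residue formula.\<close>

lemma growth_one:
  assumes S: "finite S" "0 \<notin> S"
  shows "growth k (\<lambda>_. 1) S = moment k S"
proof -
  have "moment k S = (\<Sum>x\<in>S. residue_at upper lower S x * upper x ^ k)
      + (\<Prod>y\<in>S. lower y / upper y) * 0 ^ k"
    unfolding moment_def using S
    by (intro moment_series_nth) (auto intro: inj_on_subset[OF upper_inj] gr0I simp: upper_eq_0)
  also have "(\<Sum>x\<in>S. residue_at upper lower S x * upper x ^ k) = (\<Sum>x\<in>S. add_weight S x * upper x ^ k)"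
    using S by (intro sum.cong) (auto simp: add_weight_def)
  finally show ?thesis
    using S by (simp add: growth_def add_weight_def upper_def)
qed

lemma psum_add_box:
  assumes S: "finite S" "0 \<notin> S" and x: "x \<in> insert 0 S" "Suc x \<notin> S" and r: "0 < r"
  shows "psum r (add_box S x) = psum r S + ((of_nat x + 1) ^ r - of_nat x ^ r)"
proof -
  have "psum r S = psum r (S - {x}) + of_nat x ^ r"
  proof (cases "x = 0")
    \<comment> \<open>Nothing is taken out of \<open>S\<close>, and \<open>0 ^ r = 0\<close> because
      \<open>r\<close> is positive.\<close>
    case True
    with S r show ?thesis by simp
  next
    case False
    with S x show ?thesis by (simp add: psum_def sum.remove[of S x])
  qed
  with S x show ?thesis by (simp add: psum_def add_box_def algebra_simps)
qed

text \<open>With \<open>\<alpha> = x + 1\<close> and \<open>\<beta> = - x\<close> the increment \<open>\<alpha>\<^sup>r + \<beta>\<^sup>r\<close> of an odd power satisfies a linear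
  recurrence in \<open>\<alpha> + \<beta> = 1\<close> and \<open>- \<alpha>\<beta> = x (x + 1)\<close>, hence is a polynomial in \<open>x (x + 1)\<close>.\<close>
lemma odd_power_increment:
  "\<exists>E :: rat poly. degree E \<le> j \<and> (\<forall>x. (x + 1) ^ (2 * j + 1) - x ^ (2 * j + 1) = poly E (x * (x + 1)))"
proof (induction j rule: induct_nat_012)
  case 0
  show ?case by (intro exI[of _ 1]) auto
next
  case 1
  show ?case by (intro exI[of _ "[:1, 3:]"]) (auto simp: algebra_simps power3_eq_cube)
next
  case (ge2 j)
  then obtain E E' :: "rat poly" where E: "degree E \<le> j" "degree E' \<le> Suc j"
    and E1: "\<And>x. (x + 1) ^ (2 * j + 1) - x ^ (2 * j + 1) = poly E (x * (x + 1))"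
    and E2: "\<And>x. (x + 1) ^ (2 * Suc j + 1) - x ^ (2 * Suc j + 1) = poly E' (x * (x + 1))"
    by blast
  show ?case
  proof (intro exI conjI allI)
    \<comment> \<open>The exponent rises by 2, so the recurrence has the coefficients \<alpha>^2 +
      \<beta>^2 = 1 + 2 x (x + 1) and (\<alpha> \<beta>)^2 = (x (x + 1))^2.\<close>
    show "degree ([:1, 2:] * E' - [:0, 0, 1:] * E) \<le> Suc (Suc j)"
      using E degree_mult_le[of "[:1, 2::rat:]" E'] degree_mult_le[of "[:0, 0, 1::rat:]" E]
      by (intro degree_diff_le) auto
    fix x :: rat
    have "(x + 1) ^ (2 * Suc (Suc j) + 1) - x ^ (2 * Suc (Suc j) + 1) =
      (1 + 2 * (x * (x + 1))) * ((x + 1) ^ (2 * Suc j + 1) - x ^ (2 * Suc j + 1))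
      - (x * (x + 1))^2 * ((x + 1) ^ (2 * j + 1) - x ^ (2 * j + 1))"
      by (simp add: algebra_simps power2_eq_square)
    then show "(x + 1) ^ (2 * Suc (Suc j) + 1) - x ^ (2 * Suc (Suc j) + 1) =
        poly ([:1, 2:] * E' - [:0, 0, 1:] * E) (x * (x + 1))"
      unfolding E1 E2 by (simp add: algebra_simps power2_eq_square)
  qed
qed

text \<open>Replacing y by -y exchanges the two bases, so the difference is odd in \<open>y\<close>;
  hence only odd power sums enter the moments. The degree bound comes from the recurrence for a^n -
  b^n with a + b = 2 y^2 and a b = y^4 - y^2.\<close>

lemma upper_lower_power_diff:
  "\<exists>D :: rat poly. degree D < Suc r \<and> (\<forall>y. (y * (y + 1)) ^ Suc r - (y * (y - 1)) ^ Suc r = y * poly D (y\<^sup>2))"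
proof (induction r rule: induct_nat_012)
  case 0
  show ?case by (intro exI[of _ 2]) (auto simp: algebra_simps)
next
  case 1
  show ?case by (intro exI[of _ "[:0, 4:]"]) (auto simp: algebra_simps power2_eq_square)
next
  case (ge2 r)
  then obtain D D' :: "rat poly" where D: "degree D \<le> r" "degree D' \<le> Suc r"
    and D1: "\<And>y. (y * (y + 1)) ^ Suc r - (y * (y - 1)) ^ Suc r = y * poly D (y\<^sup>2)"
    and D2: "\<And>y. (y * (y + 1)) ^ Suc (Suc r) - (y * (y - 1)) ^ Suc (Suc r) = y * poly D' (y\<^sup>2)"
    by (metis less_Suc_eq_le)
  show ?case
  proof (intro exI conjI allI)
    show "degree ([:0, 2:] * D' - [:0, -1, 1:] * D) < Suc (Suc (Suc r))"
      using D degree_mult_le[of "[:0, 2::rat:]" D'] degree_mult_le[of "[:0, -1, 1::rat:]" D]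
      unfolding less_Suc_eq_le by (intro degree_diff_le) auto
    fix y :: rat
    define a b where "a = y * (y + 1)" and "b = y * (y - 1)"
    have "a ^ Suc (Suc (Suc r)) - b ^ Suc (Suc (Suc r)) =
        (a + b) * (a ^ Suc (Suc r) - b ^ Suc (Suc r)) - a * b * (a ^ Suc r - b ^ Suc r)"
      by (simp add: algebra_simps)
    also have "\<dots> = (a + b) * (y * poly D' (y\<^sup>2)) - a * b * (y * poly D (y\<^sup>2))"
      unfolding a_def b_def D1 D2 ..
    also have "\<dots> = y * poly ([:0, 2:] * D' - [:0, -1, 1:] * D) (y\<^sup>2)"
      by (simp add: a_def b_def algebra_simps power2_eq_square)
    finally show "(y * (y + 1)) ^ Suc (Suc (Suc r)) - (y * (y - 1)) ^ Suc (Suc (Suc r)) =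
        y * poly ([:0, 2:] * D' - [:0, -1, 1:] * D) (y\<^sup>2)"
      unfolding a_def b_def .
  qed
qed

text \<open>The power sum of exponent \<open>2k + 1\<close> has weight \<open>k + 1\<close>; \<open>filt d\<close> consists of the
  polynomials in odd power sums of weight less than \<open>d\<close>, so \<open>filt 0\<close> is trivial.\<close>
inductive filt :: "nat \<Rightarrow> (nat set \<Rightarrow> rat) \<Rightarrow> bool" where
  zero: "filt d (\<lambda>_. 0)"
| const: "filt (Suc d) (\<lambda>_. c)"
| add: "filt d \<phi> \<Longrightarrow> filt d \<psi> \<Longrightarrow> filt d (\<lambda>S. \<phi> S + \<psi> S)"
| mult_psum: "filt (Suc d) \<phi> \<Longrightarrow> Suc d + k < d' \<Longrightarrow> filt d' (\<lambda>S. psum (2 * k + 1) S * \<phi> S)"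

lemma filt_mono: "filt d \<phi> \<Longrightarrow> d \<le> e \<Longrightarrow> filt e \<phi>"
proof (induction arbitrary: e rule: filt.induct)
  case (const d c)
  then show ?case by (cases e) (auto intro: filt.const)
next
  case (mult_psum d \<phi> k d')
  then show ?case by (intro filt.mult_psum[of d]) auto
qed (auto intro: filt.intros)

lemma filt_0: "filt d \<phi> \<Longrightarrow> d = 0 \<Longrightarrow> \<phi> S = 0"
  by (induction rule: filt.induct) auto

lemma filt_scale: "filt d \<phi> \<Longrightarrow> filt d (\<lambda>S. c * \<phi> S)"
proof (induction rule: filt.induct)
  case (add d \<phi> \<psi>)
  then show ?case using filt.add[of d "\<lambda>S. c * \<phi> S" "\<lambda>S. c * \<psi> S"] by (simp add: algebra_simps)
next
  case (mult_psum d \<phi> k d')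
  then show ?case using filt.mult_psum[of d "\<lambda>S. c * \<phi> S" k d'] by (simp add: mult.left_commute)
qed (auto intro: filt.intros)

lemma filt_sum: "(\<And>i. i \<in> I \<Longrightarrow> filt d (\<phi> i)) \<Longrightarrow> filt d (\<lambda>S. \<Sum>i\<in>I. \<phi> i S)"
  by (induction I rule: infinite_finite_induct) (auto intro: filt.intros)

lemma filt_mult_psum:
  assumes "filt d \<phi>"
  shows "filt (d + k + 1) (\<lambda>S. psum (2 * k + 1) S * \<phi> S)"
proof (cases d)
  case 0
  with assms have "\<phi> = (\<lambda>_. 0)" using filt_0 by blast
  then show ?thesis by (auto intro: filt.zero)
next
  case (Suc e)
  with assms show ?thesis by (intro filt.mult_psum[of e]) auto
qed

text \<open>Weights add: one factor has weight less than \<open>e\<close>, the other at most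
  \<open>d\<close>.\<close>

lemma filt_mult: "filt e \<psi> \<Longrightarrow> filt (Suc d) \<phi> \<Longrightarrow> filt (d + e) (\<lambda>S. \<psi> S * \<phi> S)"
proof (induction arbitrary: \<phi> rule: filt.induct)
  case (const e c)
  then show ?case by (auto intro: filt_scale filt_mono)
next
  case (add e \<psi> \<psi>')
  then show ?case using filt.add[of "d + e" "\<lambda>S. \<psi> S * \<phi> S" "\<lambda>S. \<psi>' S * \<phi> S"]
    by (simp add: algebra_simps)
next
  case (mult_psum e \<psi> k e')
  then show ?case using filt.mult_psum[of "d + e" "\<lambda>S. \<psi> S * \<phi> S" k "d + e'"] by (simp add: mult.assoc)
qed (auto intro: filt.intros)

lemma filt_psum: "filt (k + 2) (psum (2 * k + 1))"
  using filt.mult_psum[OF filt.const[of 0 1], of k "k + 2"] by simp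

text \<open>Summing \<open>y * poly D (y\<^sup>2)\<close> over the parts gives odd power sums of
  exponent at most 2r - 1, hence of weight at most \<open>r\<close>.\<close>

lemma filt_newton_term:
  assumes "0 < r"
  shows "filt (Suc r) (\<lambda>S. \<Sum>y\<in>S. upper y ^ r - lower y ^ r)"
proof -
  obtain s where r: "r = Suc s" using assms by (cases r) auto
  obtain D :: "rat poly" where D: "degree D < r"
    "\<And>y. (y * (y + 1)) ^ r - (y * (y - 1)) ^ r = y * poly D (y\<^sup>2)"
    using upper_lower_power_diff[of s] r by auto
  have "(\<lambda>S. \<Sum>y\<in>S. upper y ^ r - lower y ^ r) = (\<lambda>S. \<Sum>i\<le>degree D. coeff D i * psum (2 * i + 1) S)"
  proof
    fix S
    have "(\<Sum>y\<in>S. upper y ^ r - lower y ^ r) = (\<Sum>y\<in>S. \<Sum>i\<le>degree D. coeff D i * of_nat y ^ (2 * i + 1))"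
      unfolding upper_def lower_def D(2) poly_altdef
      by (simp add: sum_distrib_left power_mult[symmetric] ac_simps)
    also have "\<dots> = (\<Sum>i\<le>degree D. coeff D i * psum (2 * i + 1) S)"
      by (subst sum.swap) (simp add: psum_def sum_distrib_left)
    finally show "(\<Sum>y\<in>S. upper y ^ r - lower y ^ r) = (\<Sum>i\<le>degree D. coeff D i * psum (2 * i + 1) S)" .
  qed
  moreover have "filt (Suc r) (\<lambda>S. \<Sum>i\<le>degree D. coeff D i * psum (2 * i + 1) S)"
    using D(1) by (intro filt_sum filt_scale filt_mono[OF filt_psum]) auto
  ultimately show ?thesis by (simp only:)
qed

text \<open>Newton's identities give \<open>k\<close> times the \<open>k\<close>-th moment as a sum
  of products of an \<open>i\<close>-th moment, of weight at most \<open>i\<close>, with a term of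
  weight at most \<open>k - i\<close>.\<close>

lemma filt_moment: "\<exists>\<psi>. filt (Suc k) \<psi> \<and> (\<forall>S. finite S \<longrightarrow> moment k S = \<psi> S)"
proof (induction k rule: less_induct)
  case (less k)
  show ?case
  proof (cases "k = 0")
    case True
    then show ?thesis
      by (intro exI[of _ "\<lambda>_. 1"]) (auto intro: filt.const simp: moment_def moment_series_0)
  next
    case False
    from less obtain \<psi> where \<psi>: "\<And>i. i < k \<Longrightarrow> filt (Suc i) (\<psi> i)"
      "\<And>i S. i < k \<Longrightarrow> finite S \<Longrightarrow> moment i S = \<psi> i S"
      by metis
    define \<chi> where "\<chi> = (\<lambda>S. (1 / of_nat k) * (\<Sum>i<k. \<psi> i S * (\<Sum>y\<in>S. upper y ^ (k - i) - lower y ^ (k - i))))"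
    have "filt (Suc k) (\<lambda>S. \<psi> i S * (\<Sum>y\<in>S. upper y ^ (k - i) - lower y ^ (k - i)))" if "i \<in> {..<k}" for i
      using filt_mult[OF \<psi>(1) filt_newton_term[of "k - i"], of i] that by simp
    then have "filt (Suc k) \<chi>"
      unfolding \<chi>_def by (intro filt_scale filt_sum)
    moreover have "moment k S = \<chi> S" if "finite S" for S
      using moment_series_newton[OF that, of k upper lower] False \<psi>(2)[OF _ that]
      by (simp add: \<chi>_def moment_def field_simps del: sum_subtractf)
    ultimately show ?thesis by blast
  qed
qed

text \<open>All \<open>k\<close> are treated at once, since splitting off a power sum turns
  \<open>growth k\<close> into \<open>growth (k + i)\<close>. The leading term may have weight
  \<open>d - 1 + k\<close>, while the remainder stays strictly below; as the moment for
  \<open>k = 0\<close> is 1, T - 1 lowers the weight.\<close>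

lemma growth_leading_term:
  "filt d \<phi> \<Longrightarrow> \<exists>\<psi>. filt (d - 1 + k) \<psi> \<and>
    (\<forall>S. finite S \<longrightarrow> 0 \<notin> S \<longrightarrow> growth k \<phi> S = moment k S * \<phi> S + \<psi> S)"
proof (induction arbitrary: k rule: filt.induct)
  case (zero d)
  show ?case by (intro exI[of _ "\<lambda>_. 0"]) (auto intro: filt.zero simp: growth_def)
next
  case (const d c)
  have "growth k (\<lambda>_. c) S = moment k S * c" if "finite S" "0 \<notin> S" for S
    unfolding growth_one[OF that, symmetric] growth_def by (simp add: sum_distrib_right)
  then show ?case by (intro exI[of _ "\<lambda>_. 0"]) (auto intro: filt.zero)
next
  case (add d \<phi>1 \<phi>2)
  then obtain \<psi>1 \<psi>2 where "filt (d - 1 + k) \<psi>1" "filt (d - 1 + k) \<psi>2"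
    "\<And>S. finite S \<Longrightarrow> 0 \<notin> S \<Longrightarrow> growth k \<phi>1 S = moment k S * \<phi>1 S + \<psi>1 S"
    "\<And>S. finite S \<Longrightarrow> 0 \<notin> S \<Longrightarrow> growth k \<phi>2 S = moment k S * \<phi>2 S + \<psi>2 S"
    by metis
  moreover have "growth k (\<lambda>S. \<phi>1 S + \<phi>2 S) S = growth k \<phi>1 S + growth k \<phi>2 S" for S
    by (simp add: growth_def algebra_simps sum.distrib)
  ultimately show ?case
    by (intro exI[of _ "\<lambda>S. \<psi>1 S + \<psi>2 S"]) (auto intro: filt.add simp: algebra_simps)
next
  case (mult_psum d \<phi> j d')
  from mult_psum.IH obtain \<psi> where \<psi>: "\<And>k. filt (d + k) (\<psi> k)"
    "\<And>k S. finite S \<Longrightarrow> 0 \<notin> S \<Longrightarrow> growth k \<phi> S = moment k S * \<phi> S + \<psi> k S"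
    by (metis diff_Suc_1)
  obtain M where M: "\<And>k. filt (Suc k) (M k)" "\<And>k S. finite S \<Longrightarrow> moment k S = M k S"
    using filt_moment by metis
  obtain E :: "rat poly" where E: "degree E \<le> j"
    "\<And>x. (x + 1) ^ (2 * j + 1) - x ^ (2 * j + 1) = poly E (x * (x + 1))"
    using odd_power_increment by metis
  \<comment> \<open>The first summand is the remainder for \<phi> under the unchanged power sum; the
    others come from the powers of \<open>upper x\<close> in the increment.\<close>
  define \<chi> where "\<chi> = (\<lambda>S. psum (2 * j + 1) S * \<psi> k S
    + (\<Sum>i\<le>degree E. coeff E i * (M (k + i) S * \<phi> S + \<psi> (k + i) S)))"
  \<comment> \<open>The power sum has weight \<open>j + 1\<close>, but its increment only raises the
    moment index by \<open>i \<le> j\<close>: this is where a unit of weight is lost.\<close>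
  have "filt (d' - 1 + k) (\<lambda>S. M (k + i) S * \<phi> S + \<psi> (k + i) S)" if "i \<in> {..degree E}" for i
  proof (rule filt.add)
    show "filt (d' - 1 + k) (\<lambda>S. M (k + i) S * \<phi> S)"
      using filt_mult[OF M(1) mult_psum.hyps(1), of "k + i"] that E(1) mult_psum.hyps(2)
      by (auto elim!: filt_mono)
    show "filt (d' - 1 + k) (\<psi> (k + i))"
      using \<psi>(1)[of "k + i"] that E(1) mult_psum.hyps(2) by (auto elim!: filt_mono)
  qed
  moreover have "filt (d' - 1 + k) (\<lambda>S. psum (2 * j + 1) S * \<psi> k S)"
    using filt_mult_psum[OF \<psi>(1), of k j] mult_psum.hyps(2) by (auto elim!: filt_mono)
  ultimately have "filt (d' - 1 + k) \<chi>"
    unfolding \<chi>_def by (intro filt.add[OF _ filt_sum] filt_scale) auto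
  moreover have "growth k (\<lambda>S. psum (2 * j + 1) S * \<phi> S) S =
      moment k S * (psum (2 * j + 1) S * \<phi> S) + \<chi> S" if S: "finite S" "0 \<notin> S" for S
  proof -
    have "growth k (\<lambda>S. psum (2 * j + 1) S * \<phi> S) S =
      (\<Sum>x\<in>insert 0 S. add_weight S x * upper x ^ k *
        ((psum (2 * j + 1) S + poly E (upper x)) * \<phi> (add_box S x)))"
      unfolding growth_def
    proof (intro sum.cong refl)
      fix x assume x: "x \<in> insert 0 S"
      show "add_weight S x * upper x ^ k * (psum (2 * j + 1) (add_box S x) * \<phi> (add_box S x)) =
        add_weight S x * upper x ^ k * ((psum (2 * j + 1) S + poly E (upper x)) * \<phi> (add_box S x))"
      \<comment> \<open>The increment formula fails for a blocked part, but there the weight is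
        zero.\<close>
      proof (cases "Suc x \<in> S")
        case True
        then show ?thesis using S by (simp add: add_weight_blocked)
      next
        case False
        have "psum (2 * j + 1) (add_box S x) = psum (2 * j + 1) S + poly E (upper x)"
          unfolding upper_def E(2)[symmetric] by (rule psum_add_box[OF S x False]) simp
        then show ?thesis by (simp only:)
      qed
    qed
    also have "\<dots> = psum (2 * j + 1) S * growth k \<phi> S
        + (\<Sum>x\<in>insert 0 S. \<Sum>i\<le>degree E. coeff E i * (add_weight S x * upper x ^ (k + i) * \<phi> (add_box S x)))"
      unfolding growth_def poly_altdef sum_distrib_left sum.distrib[symmetric]
      by (intro sum.cong refl)
        (simp add: algebra_simps power_add sum_distrib_left sum_distrib_right)
    also have "(\<Sum>x\<in>insert 0 S. \<Sum>i\<le>degree E. coeff E i * (add_weight S x * upper x ^ (k + i) * \<phi> (add_box S x)))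
        = (\<Sum>i\<le>degree E. coeff E i * growth (k + i) \<phi> S)"
      unfolding growth_def sum_distrib_left by (rule sum.swap)
    finally show ?thesis
      unfolding \<chi>_def \<psi>(2)[OF S] M(2)[OF S(1), symmetric] by (simp add: algebra_simps)
  qed
  ultimately show ?case by blast
qed

section \<open>The product formula\<close>

text \<open>Schur's product formula for \<open>g\<^sup>\<lambda> / |\<lambda>|!\<close>, which stays valid if a zero part is present.\<close>

definition density :: "nat set \<Rightarrow> rat" where
  "density S = (\<Prod>x\<in>S. 1 / fact x) *
    (\<Prod>(x, y)\<in>{(x, y)\<in>S \<times> S. y < x}. (of_nat x - of_nat y) / (of_nat x + of_nat y))"

definition remove_box :: "nat set \<Rightarrow> nat \<Rightarrow> nat set" where
  "remove_box S y = insert (y - 1) (S - {y}) - {0}"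

definition covers :: "nat set \<Rightarrow> nat set \<Rightarrow> bool" where
  "covers S S' \<longleftrightarrow> (\<exists>x\<in>insert 0 S. Suc x \<notin> S \<and> S' = add_box S x)"

definition part_sets :: "nat \<Rightarrow> nat set set" where
  "part_sets n = {S. finite S \<and> 0 \<notin> S \<and> \<Sum>S = n}"

text \<open>The absolute value merges the pairs in which \<open>z\<close> is the larger part with
  those in which it is the smaller.\<close>

lemma density_insert:
  assumes R: "finite R" "z \<notin> R"
  shows "density (insert z R) =
    density R / fact z * (\<Prod>y\<in>R. \<bar>of_nat z - of_nat y\<bar> / (of_nat z + of_nat y))"
proof -
  define w :: "nat \<Rightarrow> nat \<Rightarrow> rat" where "w = (\<lambda>x y. (of_nat x - of_nat y) / (of_nat x + of_nat y))"
  let ?P = "{(x, y)\<in>R \<times> R. y < x}" and ?A = "Pair z ` {y\<in>R. y < z}" and ?B = "(\<lambda>x. (x, z)) ` {x\<in>R. z < x}"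
  have pairs: "{(x, y)\<in>insert z R \<times> insert z R. y < x} = ?P \<union> (?A \<union> ?B)" by auto
  have fin: "finite ?P" "finite ?A" "finite ?B"
    using R by (auto intro: finite_subset[of _ "R \<times> R"])
  have disj: "?P \<inter> (?A \<union> ?B) = {}" "?A \<inter> ?B = {}" using R by auto
  have "(\<Prod>(x, y)\<in>{(x, y)\<in>insert z R \<times> insert z R. y < x}. w x y) =
      (\<Prod>(x, y)\<in>?P. w x y) * ((\<Prod>(x, y)\<in>?A. w x y) * (\<Prod>(x, y)\<in>?B. w x y))"
    unfolding pairs using fin disj by (simp only: prod.union_disjoint finite_Un simp_thms)
  also have "(\<Prod>(x, y)\<in>?A. w x y) = (\<Prod>y\<in>{y\<in>R. y < z}. \<bar>of_nat z - of_nat y\<bar> / (of_nat z + of_nat y))"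
    by (subst prod.reindex) (auto simp: inj_on_def w_def intro!: prod.cong)
  also have "(\<Prod>(x, y)\<in>?B. w x y) = (\<Prod>y\<in>{y\<in>R. z < y}. \<bar>of_nat z - of_nat y\<bar> / (of_nat z + of_nat y))"
    by (subst prod.reindex) (auto simp: inj_on_def w_def add.commute intro!: prod.cong)
  also have "(\<Prod>y\<in>{y\<in>R. y < z}. \<bar>of_nat z - of_nat y\<bar> / (of_nat z + of_nat y)) * \<dots> =
      (\<Prod>y\<in>{y\<in>R. y < z} \<union> {y\<in>R. z < y}. \<bar>of_nat z - of_nat y\<bar> / (of_nat z + of_nat y))"
    using R by (intro prod.union_disjoint[symmetric]) auto
  also have "{y\<in>R. y < z} \<union> {y\<in>R. z < y} = R"
    using R by auto (metis linorder_neqE_nat)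
  finally show ?thesis
    using R by (simp add: density_def w_def)
qed

text \<open>The algebra of a single factor. \<open>N\<close> and \<open>M\<close> will be the
  absolute values of \<open>c\<close> and \<open>d\<close>, and the first hypothesis then says that
  \<open>c\<close> and \<open>d\<close> have the same sign.\<close>

lemma cross_ratio:
  fixes N M c d p q :: "'a::field"
  assumes "N * d = M * c" "p \<noteq> 0" "q \<noteq> 0" "d \<noteq> 0"
  shows "N / q = M / p * (c * p / (d * q))"
  using assms by (simp add: field_simps)

text \<open>A zero part contributes only factors 1, so shrinking a part 1 to nothing can be treated
  like any other removal.\<close>

lemma density_remove_0:
  assumes "finite S"
  shows "density (S - {0}) = density S"
proof (cases "0 \<in> S")
  case True
  have "density (insert 0 (S - {0})) = density (S - {0})"
    using assms by (subst density_insert) (auto intro!: prod.neutral)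
  with True show ?thesis by (simp add: insert_absorb)
qed simp

text \<open>A part growing from \<open>x > 0\<close> to \<open>x + 1\<close> is a box off the main diagonal and carries a factor 2.\<close>
lemma density_add_box:
  assumes S: "finite S" "0 \<notin> S" and x: "x \<in> insert 0 S" "Suc x \<notin> S"
  shows "(if x = 0 then 1 else 2) * density (add_box S x) = density S * add_weight S x"
proof (cases "x = 0")
  case True
  have "(\<Prod>y\<in>S. \<bar>of_nat 1 - of_nat y\<bar> / (of_nat 1 + of_nat y)) = (\<Prod>y\<in>S. lower y / upper y)"
  proof (intro prod.cong refl)
    fix y assume "y \<in> S"
    then have "0 < y" using S by (auto intro: gr0I)
    then show "\<bar>of_nat 1 - of_nat y\<bar> / (of_nat 1 + of_nat y) = lower y / upper y"
      by (simp add: lower_def upper_def add.commute)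
  qed
  with True S x show ?thesis
    by (simp add: add_box_def add_weight_def density_insert)
next
  case False
  define R where "R = S - {x}"
  have R: "finite R" "x \<notin> R" "Suc x \<notin> R" and S': "S = insert x R"
    using S x False by (auto simp: R_def)
  have quotient: "\<bar>of_nat (Suc x) - of_nat y\<bar> / (of_nat (Suc x) + of_nat y) =
      \<bar>of_nat x - of_nat y\<bar> / (of_nat x + of_nat y) * ((upper x - lower y) / (upper x - upper y))"
    if "y \<in> R" for y
  proof -
    have y: "y \<noteq> x" "y \<noteq> Suc x" "0 < y" using that R S S' by (auto intro: gr0I)
    define a b :: rat where "a = of_nat x" and "b = of_nat y"
    have ab: "a \<ge> 0" "b > 0" using y by (auto simp: a_def b_def)
    have up: "upper x - lower y = (a + 1 - b) * (a + b)" "upper x - upper y = (a - b) * (a + b + 1)"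
      by (simp_all add: upper_def lower_def a_def b_def algebra_simps)
    \<comment> \<open>Since \<open>y\<close> is neither \<open>x\<close> nor \<open>Suc x\<close>,
      the differences from both lie on the same side of 0.\<close>
    have cases: "a + 1 < b \<or> a > b"
    proof -
      have "Suc x < y \<or> y < x" using y by linarith
      then have "(of_nat (Suc x) :: rat) < of_nat y \<or> (of_nat y :: rat) < of_nat x"
        by (simp only: of_nat_less_iff)
      then show ?thesis by (simp add: a_def b_def add.commute)
    qed
    then have cross: "\<bar>a + 1 - b\<bar> * (a - b) = \<bar>a - b\<bar> * (a + 1 - b)"
      by (auto simp: abs_if algebra_simps)
    have "\<bar>a + 1 - b\<bar> / (a + 1 + b) = \<bar>a - b\<bar> / (a + b) * ((a + 1 - b) * (a + b) / ((a - b) * (a + 1 + b)))"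
      by (rule cross_ratio[OF cross]) (use cases ab in auto)
    then show ?thesis unfolding up by (simp add: a_def b_def add.commute add.left_commute)
  qed
  have "2 * density (add_box S x) = 2 * (density R / fact (Suc x) *
      (\<Prod>y\<in>R. \<bar>of_nat (Suc x) - of_nat y\<bar> / (of_nat (Suc x) + of_nat y)))"
    unfolding add_box_def R_def[symmetric] density_insert[OF R(1,3)] ..
  also have "(\<Prod>y\<in>R. \<bar>of_nat (Suc x) - of_nat y\<bar> / (of_nat (Suc x) + of_nat y)) =
      (\<Prod>y\<in>R. \<bar>of_nat x - of_nat y\<bar> / (of_nat x + of_nat y)) *
      (\<Prod>y\<in>R. (upper x - lower y) / (upper x - upper y))"
    unfolding prod.distrib[symmetric] using quotient by (intro prod.cong) auto
  also have "2 * (density R / fact (Suc x) * \<dots>) = density S * ((2 / (of_nat x + 1)) *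
      (\<Prod>y\<in>R. (upper x - lower y) / (upper x - upper y)))"
    unfolding S' density_insert[OF R(1,2)] fact_Suc
    by (simp only: divide_inverse inverse_mult_distrib of_nat_Suc ac_simps)
  \<comment> \<open>The factor 2 and the quotient of factorials together form the factor of
    \<open>x\<close> itself in the residue.\<close>
  also have "2 / (of_nat x + 1) = (upper x - lower x) / upper x"
  proof -
    have "upper x - lower x = of_nat x * 2" by (simp add: upper_def lower_def algebra_simps)
    then show ?thesis using False by (simp add: upper_def)
  qed
  finally show ?thesis
    using False by (simp add: add_weight_def residue_at_def R_def)
qed

text \<open>Mirror image of adding a box, with \<open>upper\<close> and \<open>lower\<close>
  exchanged. Here \<open>upper y - lower y\<close> is 2y, and y is the quotient of the factorials of
  \<open>y\<close> and \<open>y - 1\<close>.\<close>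

lemma density_remove_box:
  assumes S: "finite S" "0 \<notin> S" and y: "y \<in> S" "y - 1 \<notin> S"
  shows "2 * density (remove_box S y) =
    density S * (upper y - lower y) * (\<Prod>z\<in>S - {y}. (lower y - upper z) / (lower y - lower z))"
proof -
  define R where "R = S - {y}"
  obtain x where x: "y = Suc x" using S y by (cases y) auto
  have R: "finite R" "y \<notin> R" "x \<notin> R" and S': "S = insert y R"
    using S y by (auto simp: R_def x)
  have quotient: "\<bar>of_nat x - of_nat z\<bar> / (of_nat x + of_nat z) =
      \<bar>of_nat y - of_nat z\<bar> / (of_nat y + of_nat z) * ((lower y - upper z) / (lower y - lower z))"
    if "z \<in> R" for z
  proof -
    have z: "z \<noteq> x" "z \<noteq> Suc x" "0 < z" using that R S S' x by (auto intro: gr0I)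
    define a b :: rat where "a = of_nat x" and "b = of_nat z"
    have ab: "a \<ge> 0" "b > 0" using z by (auto simp: a_def b_def)
    have lo: "lower y - upper z = (a - b) * (a + b + 1)" "lower y - lower z = (a + 1 - b) * (a + b)"
      by (simp_all add: x upper_def lower_def a_def b_def algebra_simps)
    have cases: "a + 1 < b \<or> a > b"
    proof -
      have "Suc x < z \<or> z < x" using z by linarith
      then have "(of_nat (Suc x) :: rat) < of_nat z \<or> (of_nat z :: rat) < of_nat x"
        by (simp only: of_nat_less_iff)
      then show ?thesis by (simp add: a_def b_def add.commute)
    qed
    then have cross: "\<bar>a + 1 - b\<bar> * (a - b) = \<bar>a - b\<bar> * (a + 1 - b)"
      by (auto simp: abs_if algebra_simps)
    have "\<bar>a - b\<bar> / (a + b) = \<bar>a + 1 - b\<bar> / (a + 1 + b) * ((a - b) * (a + 1 + b) / ((a + 1 - b) * (a + b)))"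
      by (rule cross_ratio[OF cross[symmetric]]) (use cases ab in auto)
    then show ?thesis unfolding lo by (simp add: a_def b_def x add.commute add.left_commute)
  qed
  have rearrange: "2 * (density R / fact x * (P * Q)) = density R / fact y * P * (2 * of_nat y) * Q" for P Q
    unfolding x fact_Suc by (simp add: divide_simps del: of_nat_Suc)
  have box: "remove_box S y = insert x R - {0}" by (simp add: remove_box_def R_def x)
  have "2 * density (remove_box S y) = 2 * (density R / fact x *
      (\<Prod>z\<in>R. \<bar>of_nat x - of_nat z\<bar> / (of_nat x + of_nat z)))"
    unfolding box using R density_remove_0[of "insert x R"] density_insert[OF R(1,3)] by simp
  also have "(\<Prod>z\<in>R. \<bar>of_nat x - of_nat z\<bar> / (of_nat x + of_nat z)) =
      (\<Prod>z\<in>R. \<bar>of_nat y - of_nat z\<bar> / (of_nat y + of_nat z)) *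
      (\<Prod>z\<in>R. (lower y - upper z) / (lower y - lower z))"
    unfolding prod.distrib[symmetric] using quotient by (intro prod.cong) auto
  also have "2 * (density R / fact x * \<dots>) = density S * (2 * of_nat y) *
      (\<Prod>z\<in>R. (lower y - upper z) / (lower y - lower z))"
    unfolding S' density_insert[OF R(1,2)] by (rule rearrange)
  also have "2 * of_nat y = upper y - lower y"
    by (simp add: upper_def lower_def algebra_simps)
  finally show ?thesis by (simp add: R_def)
qed

text \<open>In terms of path numbers this is the branching rule: \<open>g_straight\<close> is the
  sum of its values over all ways of removing a box.\<close>

lemma sum_density_remove_box:
  assumes S: "finite S" "0 \<notin> S"
  shows "(\<Sum>y | y \<in> S \<and> y - 1 \<notin> S. density (remove_box S y)) = of_nat (\<Sum>S) * density S"
proof -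
  let ?P = "\<lambda>y. \<Prod>z\<in>S - {y}. (lower y - upper z) / (lower y - lower z)"
  have pos: "0 < y" if "y \<in> S" for y using S that by (auto intro: gr0I)
  have "inj_on lower S"
  proof (rule inj_onI)
    fix x y assume "x \<in> S" "y \<in> S" "lower x = lower y"
    then obtain x' y' where xy: "x = Suc x'" "y = Suc y'" using pos by (metis gr0_implies_Suc)
    with \<open>lower x = lower y\<close> show "x = y" using injD[OF upper_inj] by (simp add: lower_Suc)
  qed
  moreover have "0 \<le> lower y" for y by (cases y) (auto simp: lower_Suc upper_def, simp add: lower_def)
  \<comment> \<open>\<open>sum_residues\<close> asks for nonzero poles, but
    \<open>lower 1 = 0\<close>. Only differences occur in the identity, so all values are shifted by
    1.\<close>
  ultimately have "(\<Sum>y\<in>S. (lower y - upper y) * ?P y) = (\<Sum>y\<in>S. lower y - upper y)"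
    using sum_residues[of S "\<lambda>y. lower y + 1" "\<lambda>y. upper y + 1"] S
    by (simp add: inj_on_def add_nonneg_eq_0_iff del: sum_subtractf)
  also have "\<dots> = (\<Sum>y\<in>S. - 2 * of_nat y)"
    by (intro sum.cong) (auto simp: lower_def upper_def algebra_simps)
  also have "\<dots> = - 2 * of_nat (\<Sum>S)"
    by (simp only: sum_distrib_left of_nat_sum)
  finally have main: "(\<Sum>y\<in>S. (upper y - lower y) * ?P y) = 2 * of_nat (\<Sum>S)"
    by (simp add: left_diff_distrib sum_subtractf)
  \<comment> \<open>A part \<open>y\<close> with \<open>y - 1\<close> present cannot shrink; its
    term vanishes because \<open>upper (y - 1) = lower y\<close>, so the sum may run over all of
    \<open>S\<close>.\<close>
  have zero: "?P y = 0" if "y \<in> S" "y - 1 \<in> S" for y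
    using that S pos[OF that(1)]
    by (intro prod_zero bexI[of _ "y - 1"]) (auto simp: lower_Suc[symmetric])
  have "2 * (\<Sum>y | y \<in> S \<and> y - 1 \<notin> S. density (remove_box S y)) =
      (\<Sum>y | y \<in> S \<and> y - 1 \<notin> S. density S * ((upper y - lower y) * ?P y))"
    unfolding sum_distrib_left
    by (intro sum.cong refl) (use density_remove_box[OF S] in \<open>simp add: mult.assoc\<close>)
  also have "\<dots> = (\<Sum>y\<in>S. density S * ((upper y - lower y) * ?P y))"
    using S zero by (intro sum.mono_neutral_left) auto
  also have "\<dots> = 2 * (of_nat (\<Sum>S) * density S)"
    unfolding sum_distrib_left[symmetric] main by simp
  finally show ?thesis by simp
qed

section \<open>Adding and removing boxes on sets of parts\<close>

lemma add_box_part_sets: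
  assumes "S \<in> part_sets n" "x \<in> insert 0 S" "Suc x \<notin> S"
  shows "add_box S x \<in> part_sets (Suc n)"
proof -
  have S: "finite S" "0 \<notin> S" "\<Sum>S = n" using assms(1) by (auto simp: part_sets_def)
  have "\<Sum>S = \<Sum>(S - {x}) + x"
  proof (cases "x = 0")
    case False
    then show ?thesis using sum.remove[of S x "\<lambda>x. x"] S assms(2) by simp
  qed (use S in simp)
  with assms show ?thesis by (auto simp: part_sets_def add_box_def)
qed

lemma card_add_box:
  assumes "S \<in> part_sets n" "x \<in> insert 0 S" "Suc x \<notin> S"
  shows "card (add_box S x) = card S + (if x = 0 then 1 else 0)"
proof (cases "x = 0")
  case False
  then have "card S = Suc (card (S - {x}))"
    using assms card_Suc_Diff1[of S x] by (auto simp: part_sets_def)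
  with False assms show ?thesis by (simp add: part_sets_def add_box_def)
qed (use assms in \<open>auto simp: part_sets_def add_box_def\<close>)

lemma covers_Suc:
  assumes "S \<in> part_sets n" "S' \<in> part_sets n'" "covers S S'"
  shows "n' = Suc n"
  using assms add_box_part_sets[OF assms(1)] unfolding covers_def by (metis (mono_tags) part_sets_def mem_Collect_eq)

lemma covers_iff_remove_box:
  assumes "0 \<notin> S" "0 \<notin> S'"
  shows "covers S S' \<longleftrightarrow> (\<exists>y\<in>S'. y - 1 \<notin> S' \<and> S = remove_box S' y)"
proof
  assume "covers S S'"
  then obtain x where x: "x \<in> insert 0 S" "Suc x \<notin> S" "S' = add_box S x" by (auto simp: covers_def)
  then show "\<exists>y\<in>S'. y - 1 \<notin> S' \<and> S = remove_box S' y"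
    using assms by (intro bexI[of _ "Suc x"]) (auto simp: add_box_def remove_box_def)
next
  assume "\<exists>y\<in>S'. y - 1 \<notin> S' \<and> S = remove_box S' y"
  then obtain y where y: "y \<in> S'" "y - 1 \<notin> S'" "S = remove_box S' y" by blast
  then obtain x where "y = Suc x" using assms by (cases y) auto
  with y assms show "covers S S'"
    unfolding covers_def by (intro bexI[of _ x]) (auto simp: add_box_def remove_box_def)
qed

text \<open>The removal is read backwards as an addition, whose effect on the size is known.\<close>

lemma remove_box_part_sets:
  assumes S': "S' \<in> part_sets (Suc n)" and "y \<in> S'" "y - 1 \<notin> S'"
  shows "remove_box S' y \<in> part_sets n"
proof -
  have "0 \<notin> S'" using S' by (simp add: part_sets_def)
  have "covers (remove_box S' y) S'"
    using assms(2,3) by (subst covers_iff_remove_box[OF _ \<open>0 \<notin> S'\<close>]) (auto simp: remove_box_def)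
  moreover have sub: "remove_box S' y \<in> part_sets (\<Sum>(remove_box S' y))"
    using assms by (auto simp: part_sets_def remove_box_def)
  ultimately have "Suc n = Suc (\<Sum>(remove_box S' y))"
    by (intro covers_Suc[OF _ S'])
  with sub show ?thesis by simp
qed

lemma inj_add_box: "inj_on (add_box S) {x. Suc x \<notin> S}"
proof (rule inj_onI)
  fix x y assume x: "x \<in> {x. Suc x \<notin> S}" and eq: "add_box S x = add_box S y"
  from x have "Suc x \<in> add_box S x - S" by (simp add: add_box_def)
  then show "x = y" unfolding eq by (auto simp: add_box_def)
qed

lemma inj_remove_box: "inj_on (remove_box S) (S - {0})"
proof (rule inj_onI)
  fix x y assume x: "x \<in> S - {0}" and y: "y \<in> S - {0}" and eq: "remove_box S x = remove_box S y"
  from x have "x \<notin> remove_box S x" by (auto simp: remove_box_def)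
  then show "x = y" unfolding eq using x by (simp add: remove_box_def)
qed

section \<open>Shifted diagrams and paths\<close>

text \<open>Padding with zeros makes the creation of a new row an ordinary update of one row
  length.\<close>

definition row :: "nat list \<Rightarrow> nat \<Rightarrow> nat" where
  "row l i = (if i < length l then l ! i else 0)"

lemma mem_shifted_diagram: "(i, j) \<in> shifted_diagram l \<longleftrightarrow> 1 \<le> i \<and> i \<le> j \<and> j < i + row l (i - 1)"
  by (auto simp: shifted_diagram_def row_def)

lemma card_diagram_row: "card {j. (Suc i, j) \<in> shifted_diagram l} = row l i"
proof -
  have "{j. (Suc i, j) \<in> shifted_diagram l} = {Suc i..<Suc i + row l i}"
    by (auto simp: mem_shifted_diagram)
  then show ?thesis by simp
qed

text \<open>Row lengths are cardinalities of the rows of the diagram, so one new box raises exactly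
  one of them; conversely the new box goes at the end of its row.\<close>

lemma adds_one_box_iff_row: "adds_one_box l l' \<longleftrightarrow> (\<exists>i. row l' = (row l)(i := Suc (row l i)))"
proof
  assume "adds_one_box l l'"
  then obtain p q where b: "(p, q) \<notin> shifted_diagram l"
    "shifted_diagram l' = insert (p, q) (shifted_diagram l)"
    unfolding adds_one_box_def by auto
  have "(p, q) \<in> shifted_diagram l'" by (simp add: b(2))
  then obtain i where i: "p = Suc i" by (cases p) (auto simp: mem_shifted_diagram)
  have "row l' k = ((row l)(i := Suc (row l i))) k" for k
  proof (cases "k = i")
    case True
    have "{j. (Suc i, j) \<in> shifted_diagram l'} = insert q {j. (Suc i, j) \<in> shifted_diagram l}"
      unfolding b(2) i by auto
    moreover have "finite {j. (Suc i, j) \<in> shifted_diagram l}"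
      by (rule finite_subset[of _ "{..<Suc i + row l i}"]) (auto simp: mem_shifted_diagram)
    ultimately have "row l' i = Suc (row l i)"
      using b(1) by (simp add: card_diagram_row[symmetric] i)
    with True show ?thesis by simp
  next
    case False
    have "{j. (Suc k, j) \<in> shifted_diagram l'} = {j. (Suc k, j) \<in> shifted_diagram l}"
      unfolding b(2) i using False by auto
    with False show ?thesis using card_diagram_row[of k l] card_diagram_row[of k l'] by simp
  qed
  then show "\<exists>i. row l' = (row l)(i := Suc (row l i))" by blast
next
  assume "\<exists>i. row l' = (row l)(i := Suc (row l i))"
  then obtain i where i: "row l' = (row l)(i := Suc (row l i))" by blast
  show "adds_one_box l l'"
    unfolding adds_one_box_def
  proof (intro exI conjI)
    show "(Suc i, Suc i + row l i) \<notin> shifted_diagram l"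
      by (simp add: mem_shifted_diagram)
    show "shifted_diagram l' = insert (Suc i, Suc i + row l i) (shifted_diagram l)"
      by (auto simp: set_eq_iff mem_shifted_diagram i)
  qed
qed

section \<open>Strict partitions as sets of parts\<close>

lemma strict_partition_iff: "strict_partition l \<longleftrightarrow> sorted_wrt (>) l \<and> 0 \<notin> set l"
proof -
  have "sorted_wrt (\<ge>) l \<and> distinct l \<longleftrightarrow> sorted_wrt (>) (l :: nat list)"
    by (induction l) (auto simp: order_less_le)
  then show ?thesis by (auto simp: strict_partition_def is_partition_def intro: gr0I)
qed

lemma strict_partition_eqI:
  assumes "strict_partition l" "strict_partition l'" "set l = set l'"
  shows "l = l'"
proof -
  have "sorted (rev l)" "distinct (rev l)" "sorted (rev l')" "distinct (rev l')"
    using assms by (auto simp: strict_partition_def is_partition_def sorted_wrt_rev)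
  then have "rev l = rev l'"
    using assms(3) by (intro sorted_distinct_set_unique) auto
  then show ?thesis by simp
qed

lemma set_strict_partition: "l \<in> strict_partitions n \<Longrightarrow> set l \<in> part_sets n"
  by (auto simp: strict_partitions_def part_sets_def strict_partition_def is_partition_def
      sum_list_distinct_conv_sum_set[where f = "\<lambda>x. x", simplified])

lemma bij_betw_set_strict_partitions: "bij_betw set (strict_partitions n) (part_sets n)"
proof (rule bij_betwI')
  fix l l' assume "l \<in> strict_partitions n" "l' \<in> strict_partitions n"
  then show "(set l = set l') = (l = l')"
    using strict_partition_eqI by (auto simp: strict_partitions_def)
next
  fix S assume S: "S \<in> part_sets n"
  let ?l = "rev (sorted_list_of_set S)"
  have "sorted_wrt (\<ge>) ?l" by (simp add: sorted_wrt_rev)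
  moreover have "sum_list ?l = n"
    using S sum_list_distinct_conv_sum_set[of "sorted_list_of_set S" "\<lambda>x. x"]
    by (simp add: part_sets_def)
  ultimately show "\<exists>l\<in>strict_partitions n. S = set l"
    using S by (intro bexI[of _ ?l])
      (auto simp: strict_partitions_def strict_partition_def is_partition_def part_sets_def intro: gr0I)
qed (rule set_strict_partition)

lemma length_strict_partition: "strict_partition l \<Longrightarrow> length l = card (set l)"
  by (simp add: strict_partition_def distinct_card)

lemma row_strict_partition:
  assumes "strict_partition l"
  shows "set l = range (row l) - {0}" and "row l i = row l j \<Longrightarrow> row l i \<noteq> 0 \<Longrightarrow> i = j"
proof -
  have "0 \<notin> set l" "distinct l" using assms by (auto simp: strict_partition_def is_partition_def)
  then show "set l = range (row l) - {0}"
    by (force simp: row_def in_set_conv_nth image_iff)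
  show "row l i = row l j \<Longrightarrow> row l i \<noteq> 0 \<Longrightarrow> i = j"
    using \<open>distinct l\<close> by (auto simp: row_def nth_eq_iff_index_eq split: if_splits)
qed

lemma adds_one_box_iff_covers:
  assumes l: "strict_partition l" and l': "strict_partition l'"
  shows "adds_one_box l l' \<longleftrightarrow> covers (set l) (set l')"
proof
  assume "adds_one_box l l'"
  then obtain i where i: "row l' = (row l)(i := Suc (row l i))"
    by (auto simp: adds_one_box_iff_row)
  have "row l i \<in> insert 0 (set l)"
    unfolding row_strict_partition(1)[OF l] by auto
  \<comment> \<open>Otherwise \<open>l'\<close> would have two equal nonzero rows.\<close>
  moreover have "Suc (row l i) \<notin> set l"
  proof
    assume "Suc (row l i) \<in> set l"
    then obtain k where k: "row l k = Suc (row l i)"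
      unfolding row_strict_partition(1)[OF l] by (metis DiffD1 rangeE)
    then have "k \<noteq> i" by auto
    then have "row l' k = row l' i" "row l' k \<noteq> 0" using k by (auto simp: i)
    with \<open>k \<noteq> i\<close> row_strict_partition(2)[OF l'] show False by blast
  qed
  moreover have "set l' = add_box (set l) (row l i)"
  proof -
    have "range (row l') = insert (Suc (row l i)) (row l ` (UNIV - {i}))"
      unfolding i by auto
    moreover have "row l ` (UNIV - {i}) - {0} = range (row l) - {0} - {row l i}"
      using row_strict_partition(2)[OF l] by (auto simp: image_iff)
    ultimately show ?thesis
      unfolding row_strict_partition(1)[OF l] row_strict_partition(1)[OF l'] add_box_def by auto
  qed
  ultimately show "covers (set l) (set l')" unfolding covers_def by blast
next
  assume "covers (set l) (set l')"
  then obtain x where x: "x \<in> insert 0 (set l)" "Suc x \<notin> set l" "set l' = add_box (set l) x"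
    by (auto simp: covers_def)
  have sorted: "sorted_wrt (>) l" and pos: "0 \<notin> set l"
    using l by (auto simp: strict_partition_iff)
  show "adds_one_box l l'"
  proof (cases "x = 0")
    case True
    have "y > 1" if "y \<in> set l" for y
    proof -
      have "y \<noteq> 0" "y \<noteq> 1" using that pos x(2) True One_nat_def by metis+
      then show ?thesis by linarith
    qed
    then have "strict_partition (l @ [1])"
      using sorted pos by (auto simp: strict_partition_iff sorted_wrt_append)
    moreover have "set (l @ [1]) = set l'"
      using x True pos by (auto simp: add_box_def)
    ultimately have "l' = l @ [1]" using l' strict_partition_eqI by blast
    then have "row l' = (row l)(length l := Suc (row l (length l)))"
      by (auto simp: row_def nth_append fun_eq_iff)
    then show ?thesis by (auto simp: adds_one_box_iff_row)
  next
    case False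
    then obtain i where i: "i < length l" "l ! i = x"
      using x(1) by (auto simp: in_set_conv_nth)
    let ?l = "l[i := Suc x]"
    have gt: "l ! b < l ! a" if "a < b" "b < length l" for a b
      using sorted that by (simp add: sorted_wrt_iff_nth_less)
    have ne: "l ! a \<noteq> Suc x" if "a < length l" for a using x(2) that by (metis nth_mem)
    \<comment> \<open>Only the comparison of the raised entry with earlier ones could fail, and that
      would need an entry equal to \<open>Suc x\<close>.\<close>
    have "?l ! b < ?l ! a" if "a < b" "b < length l" for a b
      using gt[OF that] ne[of a] i that by (cases "a = i"; cases "b = i") auto
    then have "sorted_wrt (>) ?l" by (simp add: sorted_wrt_iff_nth_less)
    moreover have setl: "set ?l = insert (Suc x) (set l - {x})"
      using set_update_distinct[of l i "Suc x"] i l by (simp add: strict_partition_def)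
    ultimately have "strict_partition ?l"
      using pos by (simp add: strict_partition_iff)
    moreover have "set ?l = set l'" using setl x by (simp add: add_box_def)
    ultimately have "l' = ?l" using l' strict_partition_eqI by blast
    then have "row l' = (row l)(i := Suc (row l i))"
      using i by (auto simp: row_def fun_eq_iff)
    then show ?thesis by (auto simp: adds_one_box_iff_row)
  qed
qed

lemma sum_list_adds_one_box:
  assumes "strict_partition l" "strict_partition l'" "adds_one_box l l'"
  shows "sum_list l' = Suc (sum_list l)"
  using assms covers_Suc[OF set_strict_partition set_strict_partition, of l "sum_list l" l' "sum_list l'"]
  by (simp add: strict_partitions_def adds_one_box_iff_covers)

text \<open>Transport along the bijection \<open>set\<close>, then reindex by the part that grows,
  which the result determines.\<close>

lemma sum_successors:
  assumes l: "l \<in> strict_partitions n"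
  shows "(\<Sum>l' | l' \<in> strict_partitions (Suc n) \<and> adds_one_box l l'. \<phi> (set l')) =
    (\<Sum>x | x \<in> insert 0 (set l) \<and> Suc x \<notin> set l. \<phi> (add_box (set l) x))"
proof -
  let ?N = "{l'. l' \<in> strict_partitions (Suc n) \<and> adds_one_box l l'}"
  let ?X = "{x. x \<in> insert 0 (set l) \<and> Suc x \<notin> set l}"
  note bij = bij_betw_set_strict_partitions[of "Suc n"]
  have inj: "inj_on set ?N"
    using bij_betw_imp_inj_on[OF bij] by (rule inj_on_subset) auto
  have covers: "adds_one_box l l' \<longleftrightarrow> covers (set l) (set l')" if "l' \<in> strict_partitions (Suc n)" for l'
    using that l by (intro adds_one_box_iff_covers) (auto simp: strict_partitions_def)
  have "set ` ?N = {S' \<in> part_sets (Suc n). covers (set l) S'}"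
    using covers bij_betw_imp_surj_on[OF bij] by (auto simp: image_iff) (metis imageE)
  also have "\<dots> = add_box (set l) ` ?X"
    using add_box_part_sets[OF set_strict_partition[OF l]] by (auto simp: covers_def)
  finally have "set ` ?N = add_box (set l) ` ?X" .
  moreover have "inj_on (add_box (set l)) ?X"
    using inj_add_box by (rule inj_on_subset) auto
  ultimately show ?thesis
    using sum.reindex[OF inj, of \<phi>] sum.reindex[of "add_box (set l)" ?X \<phi>] by simp
qed

lemma sum_predecessors:
  assumes l: "l \<in> strict_partitions (Suc n)"
  shows "(\<Sum>l' | l' \<in> strict_partitions n \<and> adds_one_box l' l. \<phi> (set l')) =
    (\<Sum>y | y \<in> set l \<and> y - 1 \<notin> set l. \<phi> (remove_box (set l) y))"
proof -
  let ?N = "{l'. l' \<in> strict_partitions n \<and> adds_one_box l' l}"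
  let ?Y = "{y. y \<in> set l \<and> y - 1 \<notin> set l}"
  note bij = bij_betw_set_strict_partitions[of n]
  have pos: "0 \<notin> set l"
    using set_strict_partition[OF l] by (simp add: part_sets_def)
  have inj: "inj_on set ?N"
    using bij_betw_imp_inj_on[OF bij] by (rule inj_on_subset) auto
  have covers: "adds_one_box l' l \<longleftrightarrow> covers (set l') (set l)" if "l' \<in> strict_partitions n" for l'
    using that l by (intro adds_one_box_iff_covers) (auto simp: strict_partitions_def)
  have "set ` ?N = {S \<in> part_sets n. covers S (set l)}"
    using covers bij_betw_imp_surj_on[OF bij] by (auto simp: image_iff) (metis imageE)
  also have "\<dots> = {S \<in> part_sets n. \<exists>y\<in>set l. y - 1 \<notin> set l \<and> S = remove_box (set l) y}"
    using covers_iff_remove_box[OF _ pos] by (auto simp: part_sets_def)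
  also have "\<dots> = remove_box (set l) ` ?Y"
    using remove_box_part_sets[OF set_strict_partition[OF l]] by auto
  finally have "set ` ?N = remove_box (set l) ` ?Y" .
  moreover have "inj_on (remove_box (set l)) ?Y"
    using inj_remove_box by (rule inj_on_subset) (use pos in auto)
  ultimately show ?thesis
    using sum.reindex[OF inj, of \<phi>] sum.reindex[of "remove_box (set l)" ?Y \<phi>] by simp
qed

section \<open>Counting chains by their last box\<close>

lemma shifted_chains_Suc:
  assumes mu: "strict_partition mu" and lam: "strict_partition lam"
    and n: "sum_list lam = Suc (n + sum_list mu)"
  shows "shifted_chains lam mu =
    (\<Union>nu\<in>{nu \<in> strict_partitions (n + sum_list mu). adds_one_box nu lam}.
      (\<lambda>c. c @ [lam]) ` shifted_chains nu mu)" (is "?L = ?R")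
proof
  show "?L \<subseteq> ?R"
  proof
    fix c assume "c \<in> ?L"
    then have c: "length c = n + 2" "c ! 0 = mu" "c ! Suc n = lam" "\<forall>nu\<in>set c. strict_partition nu"
      "\<And>i. i < Suc n \<Longrightarrow> adds_one_box (c ! i) (c ! Suc i)"
      using n by (auto simp: shifted_chains_def)
    define c' where "c' = butlast c"
    have ne: "c \<noteq> []" using c(1) by auto
    have "last c = lam" using c ne by (simp add: last_conv_nth)
    then have cc: "c = c' @ [lam]" unfolding c'_def using ne append_butlast_last_id by metis
    have len: "length c' = Suc n" using c(1) by (simp add: c'_def)
    have nth: "c' ! i = c ! i" if "i \<le> n" for i using that len by (simp add: cc nth_append)
    have strict: "strict_partition (c ! n)" using c by auto
    have add: "adds_one_box (c ! n) lam" using c(3) c(5)[of n] by simp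
    \<comment> \<open>The size matters because \<open>shifted_chains\<close> fixes the length of a
      chain through the sizes of its ends.\<close>
    have sum: "sum_list (c ! n) = n + sum_list mu"
      using sum_list_adds_one_box[OF strict lam add] n by simp
    have "c' \<in> shifted_chains (c ! n) mu"
    proof -
      have "set c' \<subseteq> set c" unfolding c'_def by (auto dest: in_set_butlastD)
      moreover have "adds_one_box (c' ! i) (c' ! Suc i)" if "i < n" for i
        using c(5)[of i] that by (simp add: nth)
      ultimately show ?thesis
        using c(2,4) nth[of 0] nth[of n] len by (auto simp: shifted_chains_def sum)
    qed
    with strict add sum show "c \<in> ?R"
      unfolding strict_partitions_def using cc by blast
  qed
  show "?R \<subseteq> ?L"
  proof
    fix c assume "c \<in> ?R"
    then obtain nu c' where nu: "nu \<in> strict_partitions (n + sum_list mu)" "adds_one_box nu lam"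
      and c': "c' \<in> shifted_chains nu mu" and c: "c = c' @ [lam]" by blast
    from c' nu have *: "length c' = Suc n" "c' ! 0 = mu" "c' ! n = nu"
      "\<forall>nu\<in>set c'. strict_partition nu" "\<And>i. i < n \<Longrightarrow> adds_one_box (c' ! i) (c' ! Suc i)"
      by (auto simp: shifted_chains_def strict_partitions_def)
    have "adds_one_box (c ! i) (c ! Suc i)" if "i < Suc n" for i
      using that * nu(2) by (cases "i = n") (auto simp: c nth_append)
    with * show "c \<in> ?L"
      using n lam by (auto simp: shifted_chains_def c nth_append)
  qed
qed

lemma card_shifted_chains_Suc:
  assumes mu: "strict_partition mu" and lam: "strict_partition lam"
    and n: "sum_list lam = Suc (n + sum_list mu)"
  shows "card (shifted_chains lam mu) =
    (\<Sum>nu | nu \<in> strict_partitions (n + sum_list mu) \<and> adds_one_box nu lam. card (shifted_chains nu mu))"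
proof -
  have last: "c ! n = nu \<and> length c = Suc n"
    if "c \<in> shifted_chains nu mu" "nu \<in> strict_partitions (n + sum_list mu)" for c nu
    using that by (auto simp: shifted_chains_def strict_partitions_def)
  have "card (shifted_chains lam mu) =
    (\<Sum>nu | nu \<in> strict_partitions (n + sum_list mu) \<and> adds_one_box nu lam.
      card ((\<lambda>c. c @ [lam]) ` shifted_chains nu mu))"
    unfolding shifted_chains_Suc[OF assms]
  proof (rule card_UN_disjoint)
    show "finite {nu \<in> strict_partitions (n + sum_list mu). adds_one_box nu lam}"
      using finite_strict_partitions by (rule rev_finite_subset) auto
    show "\<forall>nu\<in>{nu \<in> strict_partitions (n + sum_list mu). adds_one_box nu lam}.
        finite ((\<lambda>c. c @ [lam]) ` shifted_chains nu mu)"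
      by (simp add: finite_shifted_chains)
    show "\<forall>nu\<in>{nu \<in> strict_partitions (n + sum_list mu). adds_one_box nu lam}.
        \<forall>nu'\<in>{nu \<in> strict_partitions (n + sum_list mu). adds_one_box nu lam}. nu \<noteq> nu' \<longrightarrow>
          (\<lambda>c. c @ [lam]) ` shifted_chains nu mu \<inter> (\<lambda>c. c @ [lam]) ` shifted_chains nu' mu = {}"
      using last by auto
  qed
  also have "\<dots> = (\<Sum>nu | nu \<in> strict_partitions (n + sum_list mu) \<and> adds_one_box nu lam.
      card (shifted_chains nu mu))"
    by (intro sum.cong refl card_image) (auto simp: inj_on_def)
  finally show ?thesis .
qed

text \<open>Diagrams grow along a chain, so without containment there is no chain and the default
  value 0 agrees with the count.\<close>

lemma g_skew_eq_card: "sum_list mu \<le> sum_list lam \<Longrightarrow> g_skew lam mu = card (shifted_chains lam mu)"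
proof -
  have "shifted_diagram mu \<subseteq> shifted_diagram lam" if c: "c \<in> shifted_chains lam mu" for c
  proof -
    define k where "k = sum_list lam - sum_list mu"
    have c': "c ! 0 = mu" "c ! k = lam" "\<And>i. i < k \<Longrightarrow> adds_one_box (c ! i) (c ! Suc i)"
      using c by (auto simp: shifted_chains_def k_def Let_def)
    have "shifted_diagram (c ! 0) \<subseteq> shifted_diagram (c ! k)"
    proof (rule inc_induct[of 0 k "\<lambda>i. shifted_diagram (c ! i) \<subseteq> shifted_diagram (c ! k)"])
      fix i assume "i < k" "shifted_diagram (c ! Suc i) \<subseteq> shifted_diagram (c ! k)"
      with c'(3)[of i] show "shifted_diagram (c ! i) \<subseteq> shifted_diagram (c ! k)"
        by (auto simp: adds_one_box_def)
    qed auto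
    with c' show ?thesis by simp
  qed
  then have "shifted_chains lam mu = {}" if "\<not> shifted_diagram mu \<subseteq> shifted_diagram lam"
    using that by blast
  then show ?thesis by (auto simp: g_skew_def)
qed

lemma g_skew_Suc:
  assumes "mu \<in> strict_partitions m" and lam: "lam \<in> strict_partitions (Suc (n + m))"
  shows "g_skew lam mu = (\<Sum>nu | nu \<in> strict_partitions (n + m) \<and> adds_one_box nu lam. g_skew nu mu)"
proof -
  have "g_skew lam mu = (\<Sum>nu | nu \<in> strict_partitions (n + m) \<and> adds_one_box nu lam. card (shifted_chains nu mu))"
    using assms card_shifted_chains_Suc[of mu lam n]
    by (simp add: g_skew_eq_card strict_partitions_def)
  also have "\<dots> = (\<Sum>nu | nu \<in> strict_partitions (n + m) \<and> adds_one_box nu lam. g_skew nu mu)"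
    using assms by (intro sum.cong) (auto simp: g_skew_eq_card strict_partitions_def)
  finally show ?thesis .
qed

text \<open>Schur's formula: path numbers and density obey the same recursion under removal of a
  box.\<close>

lemma g_straight_eq: "lam \<in> strict_partitions n \<Longrightarrow> of_nat (g_straight lam) = fact n * density (set lam)"
proof (induction n arbitrary: lam)
  case 0
  then have lam: "lam = []"
    by (cases lam) (auto simp: strict_partitions_def strict_partition_def is_partition_def)
  have "shifted_chains [] [] = {[[]]}"
    by (auto simp: shifted_chains_def Let_def strict_partition_def is_partition_def length_Suc_conv)
  then show ?case by (simp add: lam g_straight_def g_skew_def density_def)
next
  case (Suc n)
  have S: "finite (set lam)" "0 \<notin> set lam" "\<Sum>(set lam) = Suc n"
    using set_strict_partition[OF Suc.prems] by (auto simp: part_sets_def)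
  have nil: "[] \<in> strict_partitions 0"
    by (simp add: strict_partitions_def strict_partition_def is_partition_def)
  have "(of_nat (g_straight lam) :: rat) =
      (\<Sum>nu | nu \<in> strict_partitions n \<and> adds_one_box nu lam. of_nat (g_straight nu))"
    using g_skew_Suc[OF nil, of lam n] Suc.prems by (simp add: g_straight_def)
  also have "\<dots> = (\<Sum>nu | nu \<in> strict_partitions n \<and> adds_one_box nu lam. fact n * density (set nu))"
    by (intro sum.cong) (auto simp: Suc.IH)
  also have "\<dots> = fact n * (\<Sum>y | y \<in> set lam \<and> y - 1 \<notin> set lam. density (remove_box (set lam) y))"
    by (simp only: sum_predecessors[OF Suc.prems, of "\<lambda>S. fact n * density S"] sum_distrib_left)
  also have "\<dots> = fact n * (of_nat (Suc n) * density (set lam))"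
    by (simp only: sum_density_remove_box[OF S(1,2)] S(3))
  finally show ?case by (simp add: algebra_simps)
qed

section \<open>Polynomiality\<close>

text \<open>The expectation without its constant factor \<open>fact m / g_straight mu\<close>;
  \<open>density\<close> replaces \<open>g_straight lam / fact (n + m)\<close>.\<close>

definition path_sum :: "nat list \<Rightarrow> nat \<Rightarrow> nat \<Rightarrow> (nat set \<Rightarrow> rat) \<Rightarrow> rat" where
  "path_sum mu m n \<phi> = (\<Sum>lam\<in>strict_partitions (n + m).
    2 powi (int n - int (length lam) + int (length mu)) * of_nat (g_skew lam mu)
      * density (set lam) * \<phi> (set lam))"

text \<open>Split off the last box and exchange the two sums; the inner sum over the last box is
  then the average \<open>growth 0 \<phi>\<close>.\<close>

lemma path_sum_Suc:
  assumes mu: "mu \<in> strict_partitions m"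
  shows "path_sum mu m (Suc n) \<phi> = path_sum mu m n (growth 0 \<phi>)"
proof -
  define w :: "nat \<Rightarrow> nat \<Rightarrow> rat" where
    "w = (\<lambda>n c. 2 powi (int n - int c + int (length mu)))"
  have "path_sum mu m (Suc n) \<phi> = (\<Sum>lam\<in>strict_partitions (Suc (n + m)).
      \<Sum>nu | nu \<in> strict_partitions (n + m) \<and> adds_one_box nu lam.
        of_nat (g_skew nu mu) * (w (Suc n) (card (set lam)) * density (set lam) * \<phi> (set lam)))"
    unfolding path_sum_def
  proof (intro sum.cong)
    fix lam assume "lam \<in> strict_partitions (Suc (n + m))"
    then show "2 powi (int (Suc n) - int (length lam) + int (length mu)) * of_nat (g_skew lam mu)
        * density (set lam) * \<phi> (set lam) =
      (\<Sum>nu | nu \<in> strict_partitions (n + m) \<and> adds_one_box nu lam.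
        of_nat (g_skew nu mu) * (w (Suc n) (card (set lam)) * density (set lam) * \<phi> (set lam)))"
      unfolding sum_distrib_right[symmetric] of_nat_sum[symmetric]
      using g_skew_Suc[OF mu] length_strict_partition[of lam]
      by (simp add: w_def strict_partitions_def)
  qed simp
  also have "\<dots> = (\<Sum>nu\<in>strict_partitions (n + m). \<Sum>lam | lam \<in> strict_partitions (Suc (n + m)) \<and> adds_one_box nu lam.
      of_nat (g_skew nu mu) * (w (Suc n) (card (set lam)) * density (set lam) * \<phi> (set lam)))"
    by (rule sum.swap_restrict) (rule finite_strict_partitions)+
  also have "\<dots> = path_sum mu m n (growth 0 \<phi>)"
    unfolding path_sum_def
  proof (intro sum.cong refl)
    fix nu assume nu: "nu \<in> strict_partitions (n + m)"
    let ?S = "set nu"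
    have S: "finite ?S" "0 \<notin> ?S" "?S \<in> part_sets (n + m)"
      using set_strict_partition[OF nu] by (auto simp: part_sets_def)
    have "(\<Sum>lam | lam \<in> strict_partitions (Suc (n + m)) \<and> adds_one_box nu lam.
        w (Suc n) (card (set lam)) * density (set lam) * \<phi> (set lam)) =
      (\<Sum>x | x \<in> insert 0 ?S \<and> Suc x \<notin> ?S.
        w (Suc n) (card (add_box ?S x)) * density (add_box ?S x) * \<phi> (add_box ?S x))"
      by (rule sum_successors[OF nu, of "\<lambda>S. w (Suc n) (card S) * density S * \<phi> S"])
    also have "\<dots> = (\<Sum>x | x \<in> insert 0 ?S \<and> Suc x \<notin> ?S.
        w n (card ?S) * density ?S * (add_weight ?S x * \<phi> (add_box ?S x)))"
    proof (intro sum.cong refl)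
      fix x assume "x \<in> {x. x \<in> insert 0 ?S \<and> Suc x \<notin> ?S}"
      then have x: "x \<in> insert 0 ?S" "Suc x \<notin> ?S" by auto
      \<comment> \<open>A new part raises size and length together and leaves the exponent of 2
        unchanged; a growing part raises it by 1. This matches the factor in
        \<open>density_add_box\<close>.\<close>
      have "w (Suc n) (card (add_box ?S x)) = w n (card ?S) * (if x = 0 then 1 else 2)"
      proof -
        have "w (Suc n) c = w n c * 2" "w (Suc n) (Suc c) = w n c" for c
          using power_int_add_1[of "2::rat" "int n - int c + int (length mu)"]
          by (auto simp: w_def algebra_simps)
        then show ?thesis using card_add_box[OF S(3) x] by simp
      qed
      then have "w (Suc n) (card (add_box ?S x)) * density (add_box ?S x) =
          w n (card ?S) * (density ?S * add_weight ?S x)"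
        unfolding density_add_box[OF S(1,2) x, symmetric] by simp
      then show "w (Suc n) (card (add_box ?S x)) * density (add_box ?S x) * \<phi> (add_box ?S x) =
          w n (card ?S) * density ?S * (add_weight ?S x * \<phi> (add_box ?S x))"
        by (simp add: mult.assoc)
    qed
    \<comment> \<open>Blocked parts may join the sum because their weight is zero.\<close>
    also have "\<dots> = (\<Sum>x\<in>insert 0 ?S. w n (card ?S) * density ?S * (add_weight ?S x * \<phi> (add_box ?S x)))"
      using add_weight_blocked by (intro sum.mono_neutral_left) auto
    finally show "(\<Sum>lam | lam \<in> strict_partitions (Suc (n + m)) \<and> adds_one_box nu lam.
        of_nat (g_skew nu mu) * (w (Suc n) (card (set lam)) * density (set lam) * \<phi> (set lam))) =
      2 powi (int n - int (length nu) + int (length mu)) * of_nat (g_skew nu mu)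
        * density ?S * growth 0 \<phi> ?S"
      using length_strict_partition[of nu] nu
      by (simp only: sum_distrib_left[symmetric])
        (simp add: growth_def w_def strict_partitions_def)
  qed
  finally show ?thesis .
qed

lemma path_sum_cong:
  assumes "\<And>S. finite S \<Longrightarrow> 0 \<notin> S \<Longrightarrow> \<phi> S = \<psi> S"
  shows "path_sum mu m n \<phi> = path_sum mu m n \<psi>"
  unfolding path_sum_def using assms set_strict_partition
  by (intro sum.cong refl) (auto simp: part_sets_def)

text \<open>Telescope n^(d+1): the binomial theorem isolates the sum of \<open>d\<close>-th powers
  with coefficient d + 1, and the lower powers are known by induction.\<close>

lemma poly_indefinite_sum_monom:
  "\<exists>Q :: rat poly. \<forall>n. (\<Sum>k<n. of_nat k ^ d) = poly Q (of_nat n)"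
proof (induction d rule: less_induct)
  case (less d)
  then obtain Q :: "nat \<Rightarrow> rat poly" where Q: "\<And>j n. j < d \<Longrightarrow> (\<Sum>k<n. of_nat k ^ j) = poly (Q j) (of_nat n)"
    by metis
  show ?case
  proof (intro exI allI)
    fix n :: nat
    have "(of_nat n :: rat) ^ Suc d = (\<Sum>k<n. of_nat (Suc k) ^ Suc d - of_nat k ^ Suc d)"
      by (subst sum_lessThan_telescope) simp
    also have "\<dots> = (\<Sum>k<n. \<Sum>j\<le>d. of_nat (Suc d choose j) * of_nat k ^ j)"
      by (intro sum.cong refl) (simp add: binomial_ring[of _ 1] add.commute[of 1] del: power_Suc binomial_Suc_Suc)
    also have "\<dots> = (\<Sum>j\<le>d. of_nat (Suc d choose j) * (\<Sum>k<n. of_nat k ^ j))"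
      by (subst sum.swap) (simp only: sum_distrib_left)
    also have "\<dots> = of_nat (Suc d) * (\<Sum>k<n. of_nat k ^ d)
        + (\<Sum>j<d. of_nat (Suc d choose j) * poly (Q j) (of_nat n))"
      by (simp add: lessThan_Suc_atMost[symmetric] Q del: of_nat_Suc binomial_Suc_Suc)
    finally show "(\<Sum>k<n. of_nat k ^ d) = poly (smult (1 / of_nat (Suc d))
        (monom 1 (Suc d) - (\<Sum>j<d. smult (of_nat (Suc d choose j)) (Q j)))) (of_nat n)"
      by (simp add: poly_monom poly_sum field_simps del: of_nat_Suc binomial_Suc_Suc power_Suc)
  qed
qed

lemma poly_indefinite_sum:
  "\<exists>Q :: rat poly. \<forall>n. (\<Sum>k<n. poly P (of_nat k)) = poly Q (of_nat n)"
proof -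
  obtain Q :: "nat \<Rightarrow> rat poly" where Q: "\<And>d n. (\<Sum>k<n. of_nat k ^ d) = poly (Q d) (of_nat n)"
    using poly_indefinite_sum_monom by metis
  have "(\<Sum>k<n. poly P (of_nat k)) = poly (\<Sum>i\<le>degree P. smult (coeff P i) (Q i)) (of_nat n)" for n
    by (simp add: poly_altdef[of P] poly_sum Q[symmetric] sum_distrib_left) (rule sum.swap)
  then show ?thesis by blast
qed

text \<open>Induction on the weight: the first difference in \<open>n\<close> is the path sum of T -
  1 applied to \<phi>, of lower weight and so polynomial, and partial sums of a polynomial are again
  polynomial.\<close>

lemma path_sum_polynomial:
  assumes mu: "mu \<in> strict_partitions m"
  shows "filt d \<phi> \<Longrightarrow> \<exists>P :: rat poly. \<forall>n. path_sum mu m n \<phi> = poly P (of_nat n)"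
proof (induction d arbitrary: \<phi>)
  case 0
  have "path_sum mu m n \<phi> = 0" for n
    unfolding path_sum_def filt_0[OF 0 refl] by simp
  then show ?case by (intro exI[of _ 0]) simp
next
  case (Suc d)
  have moment_0: "moment 0 S = 1" for S by (simp add: moment_def moment_series_0)
  obtain \<psi> where \<psi>: "filt d \<psi>" "\<And>S. finite S \<Longrightarrow> 0 \<notin> S \<Longrightarrow> growth 0 \<phi> S = \<phi> S + \<psi> S"
    using growth_leading_term[OF Suc.prems, of 0] unfolding moment_0 diff_Suc_1 add_0_right mult_1 by blast
  obtain P :: "rat poly" where P: "\<And>n. path_sum mu m n \<psi> = poly P (of_nat n)"
    using Suc.IH[OF \<psi>(1)] by blast
  obtain Q :: "rat poly" where Q: "\<And>n. (\<Sum>k<n. poly P (of_nat k)) = poly Q (of_nat n)"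
    using poly_indefinite_sum by blast
  have step: "path_sum mu m (Suc n) \<phi> = path_sum mu m n \<phi> + poly P (of_nat n)" for n
  proof -
    have "path_sum mu m (Suc n) \<phi> = path_sum mu m n (\<lambda>S. \<phi> S + \<psi> S)"
      unfolding path_sum_Suc[OF mu] by (rule path_sum_cong) (rule \<psi>(2))
    also have "\<dots> = path_sum mu m n \<phi> + path_sum mu m n \<psi>"
      by (simp add: path_sum_def distrib_left sum.distrib)
    finally show ?thesis unfolding P .
  qed
  have total: "path_sum mu m n \<phi> = path_sum mu m 0 \<phi> + (\<Sum>k<n. poly P (of_nat k))" for n
  proof (induction n)
    case (Suc n)
    show ?case unfolding step Suc.IH by simp
  qed simp
  show ?case
  proof (intro exI allI)
    fix n
    show "path_sum mu m n \<phi> = poly ([:path_sum mu m 0 \<phi>:] + Q) (of_nat n)"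
      unfolding total[of n] by (simp add: Q)
  qed
qed

text \<open>Evaluation respects sums and products, so it suffices to place the generators in the
  filtration.\<close>

lemma eval_partition_filt:
  "f \<in> supersymmetric_functions \<Longrightarrow>
    \<exists>d \<phi>. filt (Suc d) \<phi> \<and> (\<forall>l. strict_partition l \<longrightarrow> eval_partition f l = \<phi> (set l))"
proof (induction rule: supersymmetric_functions.induct)
  case (const c)
  show ?case
    by (intro exI[of _ 0] exI[of _ "\<lambda>_. c"]) (auto intro: filt.const simp: eval_partition_def eval_series_const)
next
  case (odd_power_sum r)
  then obtain k where r: "r = 2 * k + 1" by (auto elim: oddE)
  have "eval_partition (power_sum r) l = psum r (set l)" if "strict_partition l" for l
  proof -
    have "eval_partition (power_sum r) l = (\<Sum>i<length l. of_nat (l ! i) ^ r)"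
      unfolding eval_partition_def
      by (subst eval_series_power_sum[of "{..<length l}"]) (auto simp: r)
    \<comment> \<open>Distinctness of the parts turns the sum over positions into a sum over the
      set.\<close>
    also have "\<dots> = psum r (set l)"
      unfolding psum_def using that
      by (simp add: strict_partition_def sum_list_distinct_conv_sum_set[symmetric] sum_list_sum_nth atLeast0LessThan)
    finally show ?thesis .
  qed
  with filt_psum[of k] r show ?case
    by (intro exI[of _ "k + 1"] exI[of _ "psum r"]) auto
next
  case (add f g)
  then obtain d \<phi> e \<psi> where \<phi>: "filt (Suc d) \<phi>" and \<psi>: "filt (Suc e) \<psi>"
    and ev: "\<And>l. strict_partition l \<Longrightarrow> eval_partition f l = \<phi> (set l)"
      "\<And>l. strict_partition l \<Longrightarrow> eval_partition g l = \<psi> (set l)" by metis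
  have "filt (Suc (max d e)) (\<lambda>S. \<phi> S + \<psi> S)"
    using filt_mono[OF \<phi>] filt_mono[OF \<psi>] by (intro filt.add) auto
  moreover have "eval_partition (series_add f g) l = eval_partition f l + eval_partition g l" for l
    unfolding eval_partition_def using add.hyps supersymmetric_subset_symmetric
    by (intro eval_series_add) auto
  ultimately show ?case using ev by (intro exI[of _ "max d e"] exI[of _ "\<lambda>S. \<phi> S + \<psi> S"]) auto
next
  case (mult f g)
  then obtain d \<phi> e \<psi> where \<phi>: "filt (Suc d) \<phi>" and \<psi>: "filt (Suc e) \<psi>"
    and ev: "\<And>l. strict_partition l \<Longrightarrow> eval_partition f l = \<phi> (set l)"
      "\<And>l. strict_partition l \<Longrightarrow> eval_partition g l = \<psi> (set l)" by metis
  have "filt (Suc (e + d)) (\<lambda>S. \<phi> S * \<psi> S)"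
    using filt_mult[OF \<phi> \<psi>] by simp
  moreover have "eval_partition (series_mult f g) l = eval_partition f l * eval_partition g l" for l
    unfolding eval_partition_def using mult.hyps supersymmetric_subset_symmetric
    by (intro eval_series_mult) auto
  ultimately show ?case using ev by (intro exI[of _ "e + d"] exI[of _ "\<lambda>S. \<phi> S * \<psi> S"]) auto
qed

theorem theorem1p3:
  fixes mu :: "nat list" and m :: nat and f :: series
  assumes "mu \<in> strict_partitions m"
    and "f \<in> supersymmetric_functions"
  shows "\<exists>P :: rat poly. \<forall>n :: nat.
    (\<Sum>lam \<in> strict_partitions (n + m).
       fact m / fact (n + m)
       * 2 powi (int n - int (length lam) + int (length mu))
       * (of_nat (g_straight lam) / of_nat (g_straight mu))
       * of_nat (g_skew lam mu)
       * eval_partition f lam)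
    = poly P (of_nat n)"
proof -
  obtain d \<phi> where "filt (Suc d) \<phi>"
    and ev: "\<And>l. strict_partition l \<Longrightarrow> eval_partition f l = \<phi> (set l)"
    using eval_partition_filt[OF assms(2)] by blast
  then obtain P :: "rat poly" where P: "\<And>n. path_sum mu m n \<phi> = poly P (of_nat n)"
    using path_sum_polynomial[OF assms(1)] by blast
  \<comment> \<open>The part of the coefficient depending on neither \<open>lam\<close> nor
    \<open>n\<close>; Schur's formula cancels \<open>fact (n + m)\<close> in the rest.\<close>
  define c :: rat where "c = fact m / of_nat (g_straight mu)"
  have "(\<Sum>lam \<in> strict_partitions (n + m).
       fact m / fact (n + m)
       * 2 powi (int n - int (length lam) + int (length mu))
       * (of_nat (g_straight lam) / of_nat (g_straight mu))
       * of_nat (g_skew lam mu)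
       * eval_partition f lam) = c * path_sum mu m n \<phi>" for n
    unfolding path_sum_def sum_distrib_left
  proof (intro sum.cong refl)
    fix lam assume lam: "lam \<in> strict_partitions (n + m)"
    then have "eval_partition f lam = \<phi> (set lam)" by (simp add: ev strict_partitions_def)
    then show "fact m / fact (n + m)
       * 2 powi (int n - int (length lam) + int (length mu))
       * (of_nat (g_straight lam) / of_nat (g_straight mu))
       * of_nat (g_skew lam mu) * eval_partition f lam =
      c * (2 powi (int n - int (length lam) + int (length mu)) * of_nat (g_skew lam mu)
        * density (set lam) * \<phi> (set lam))"
      by (simp add: g_straight_eq[OF lam] c_def)
  qed
  then show ?thesis by (intro exI[of _ "smult c P"]) (simp add: P)
qed

end
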